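(* Let $f \colon X \to Y$ be a surjective continuous map of a compact Hausdorff space $X$ onto a non-trivial Peano continuum $Y$ (i.e. $Y$ has more than one point). Let $C(f) \colon C(Y) \to C(X)$, $\varphi \mapsto \varphi \circ f$, be the induced unital $\ast$-homomorphism. If $C(f)$ is doubly projective, then $f$ is a homeomorphism.
   Context: For a compact Hausdorff space $X$, $C(X)$ is the unital $C^{\ast}$-algebra of continuous complex-valued functions on $X$. A Peano continuum is a compact, connected, locally connected metrizable space. A unital $\ast$-homomorphism $i \colon S \to T$ of (not necessarily commutative) unital $C^{\ast}$-algebras is doubly projective if for any unital $C^{\ast}$-algebras $A$, $B$, any unital $\ast$-homomorphisms $u \colon S \to A$, $g \colon T \to B$ and any surjective unital $\ast$-homomorphism $p \colon A \to B$ with $g \circ i = p \circ u$, there exists a unital $\ast$-homomorphism $h \colon T \to A$ such that $u = h \circ i$ and $g = p \circ h$. The domain $S$ is not assumed to be projective, and $A$, $B$ range over all unital $C^{\ast}$-algebras, commutative or not. *)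

theory Defs
  imports "HOL-Analysis.Analysis" "HOL-Algebra.Ring"
begin

section \<open>Unital C*-algebras\<close>

record 'a cstar_algebra = "'a ring" +
  cscale :: "complex \<Rightarrow> 'a \<Rightarrow> 'a"
  cstar :: "'a \<Rightarrow> 'a"
  cnorm :: "'a \<Rightarrow> real"

text \<open>
  As for rings in HOL-Algebra, the unit may coincide with zero, so the zero algebra is included.
\<close>

locale unital_cstar_algebra = ring A for A :: "'a cstar_algebra" (structure) +
  assumes cscale_closed: "x \<in> carrier A \<Longrightarrow> cscale A c x \<in> carrier A"
    and cscale_add_left: "x \<in> carrier A \<Longrightarrow> cscale A (c + d) x = cscale A c x \<oplus> cscale A d x"
    and cscale_add_right: "\<lbrakk>x \<in> carrier A; y \<in> carrier A\<rbrakk> \<Longrightarrow>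
          cscale A c (x \<oplus> y) = cscale A c x \<oplus> cscale A c y"
    and cscale_cscale: "x \<in> carrier A \<Longrightarrow> cscale A c (cscale A d x) = cscale A (c * d) x"
    and cscale_one: "x \<in> carrier A \<Longrightarrow> cscale A 1 x = x"
    and cscale_mult_left: "\<lbrakk>x \<in> carrier A; y \<in> carrier A\<rbrakk> \<Longrightarrow>
          cscale A c x \<otimes> y = cscale A c (x \<otimes> y)"
    and cscale_mult_right: "\<lbrakk>x \<in> carrier A; y \<in> carrier A\<rbrakk> \<Longrightarrow>
          x \<otimes> cscale A c y = cscale A c (x \<otimes> y)"
    and cstar_closed: "x \<in> carrier A \<Longrightarrow> cstar A x \<in> carrier A"
    and cstar_cstar: "x \<in> carrier A \<Longrightarrow> cstar A (cstar A x) = x"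
    and cstar_add: "\<lbrakk>x \<in> carrier A; y \<in> carrier A\<rbrakk> \<Longrightarrow>
          cstar A (x \<oplus> y) = cstar A x \<oplus> cstar A y"
    and cstar_cscale: "x \<in> carrier A \<Longrightarrow> cstar A (cscale A c x) = cscale A (cnj c) (cstar A x)"
    and cstar_mult: "\<lbrakk>x \<in> carrier A; y \<in> carrier A\<rbrakk> \<Longrightarrow>
          cstar A (x \<otimes> y) = cstar A y \<otimes> cstar A x"
    and cnorm_nonneg: "x \<in> carrier A \<Longrightarrow> 0 \<le> cnorm A x"
    and cnorm_eq_0_iff: "x \<in> carrier A \<Longrightarrow> cnorm A x = 0 \<longleftrightarrow> x = \<zero>"
    and cnorm_triangle: "\<lbrakk>x \<in> carrier A; y \<in> carrier A\<rbrakk> \<Longrightarrow>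
          cnorm A (x \<oplus> y) \<le> cnorm A x + cnorm A y"
    and cnorm_cscale: "x \<in> carrier A \<Longrightarrow> cnorm A (cscale A c x) = cmod c * cnorm A x"
    and cnorm_mult: "\<lbrakk>x \<in> carrier A; y \<in> carrier A\<rbrakk> \<Longrightarrow>
          cnorm A (x \<otimes> y) \<le> cnorm A x * cnorm A y"
    and cstar_identity: "x \<in> carrier A \<Longrightarrow> cnorm A (cstar A x \<otimes> x) = (cnorm A x)\<^sup>2"
    and complete: "\<lbrakk>\<And>n. \<sigma> n \<in> carrier A;
            \<And>e. e > 0 \<Longrightarrow> \<exists>N. \<forall>m\<ge>N. \<forall>n\<ge>N. cnorm A (\<sigma> m \<ominus> \<sigma> n) < e\<rbrakk> \<Longrightarrow>
          \<exists>l\<in>carrier A. (\<lambda>n. cnorm A (\<sigma> n \<ominus> l)) \<longlonglongrightarrow> 0"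

definition unital_star_hom :: "'a cstar_algebra \<Rightarrow> 'b cstar_algebra \<Rightarrow> ('a \<Rightarrow> 'b) set" where
  "unital_star_hom A B = {h \<in> ring_hom A B.
     (\<forall>c. \<forall>x\<in>carrier A. h (cscale A c x) = cscale B c (h x)) \<and>
     (\<forall>x\<in>carrier A. h (cstar A x) = cstar B (h x))}"

section \<open>Doubly projective homomorphisms\<close>

definition lifts_against ::
    "'s cstar_algebra \<Rightarrow> 't cstar_algebra \<Rightarrow> ('s \<Rightarrow> 't) \<Rightarrow>
     'a cstar_algebra \<Rightarrow> 'b cstar_algebra \<Rightarrow> bool" where
  "lifts_against S T i A B \<longleftrightarrow>
     (\<forall>u g p. u \<in> unital_star_hom S A \<longrightarrow> g \<in> unital_star_hom T B \<longrightarrow>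
        p \<in> unital_star_hom A B \<longrightarrow> p ` carrier A = carrier B \<longrightarrow>
        (\<forall>s\<in>carrier S. g (i s) = p (u s)) \<longrightarrow>
        (\<exists>h \<in> unital_star_hom T A.
           (\<forall>s\<in>carrier S. u s = h (i s)) \<and> (\<forall>t\<in>carrier T. g t = p (h t))))"

text \<open>
  HOL cannot quantify over all types inside a formula, so in the definition below the elements of
  the test algebras \<open>A\<close> and \<open>B\<close> are drawn from the fixed type \<open>nat \<Rightarrow> 's + 't + complex\<close>.  This is
  no restriction: the theorem \<open>doubly_projective_lifts\<close> at the end of this theory derives the
  lifting property against unital C*-algebras \<open>A\<close> and \<open>B\<close> over arbitrary types.
\<close>

definition doubly_projective ::
    "'s cstar_algebra \<Rightarrow> 't cstar_algebra \<Rightarrow> ('s \<Rightarrow> 't) \<Rightarrow> bool" where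
  "doubly_projective S T i \<longleftrightarrow>
     unital_cstar_algebra S \<and> unital_cstar_algebra T \<and> i \<in> unital_star_hom S T \<and>
     (\<forall>(A :: (nat \<Rightarrow> 's + 't + complex) cstar_algebra) (B :: (nat \<Rightarrow> 's + 't + complex) cstar_algebra).
        unital_cstar_algebra A \<longrightarrow> unital_cstar_algebra B \<longrightarrow> lifts_against S T i A B)"

section \<open>The algebra of continuous functions\<close>

text \<open>
  Functions in \<open>C(X)\<close> are normalised to be \<open>undefined\<close> outside \<open>topspace X\<close>.  Inserting \<open>0\<close> in the
  supremum only matters for empty \<open>X\<close>.
\<close>

definition cont_alg :: "'x topology \<Rightarrow> ('x \<Rightarrow> complex) cstar_algebra" where
  "cont_alg X =
    \<lparr>carrier = {\<phi> \<in> extensional (topspace X). continuous_map X euclidean \<phi>},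
     monoid.mult = (\<lambda>\<phi> \<psi>. \<lambda>x\<in>topspace X. \<phi> x * \<psi> x),
     one = (\<lambda>x\<in>topspace X. 1),
     zero = (\<lambda>x\<in>topspace X. 0),
     add = (\<lambda>\<phi> \<psi>. \<lambda>x\<in>topspace X. \<phi> x + \<psi> x),
     cscale = (\<lambda>c \<phi>. \<lambda>x\<in>topspace X. c * \<phi> x),
     cstar = (\<lambda>\<phi>. \<lambda>x\<in>topspace X. cnj (\<phi> x)),
     cnorm = (\<lambda>\<phi>. Sup (insert 0 ((\<lambda>x. cmod (\<phi> x)) ` topspace X)))\<rparr>"

definition cont_alg_map :: "'x topology \<Rightarrow> ('x \<Rightarrow> 'y) \<Rightarrow> ('y \<Rightarrow> complex) \<Rightarrow> ('x \<Rightarrow> complex)" where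
  "cont_alg_map X f \<phi> = (\<lambda>x\<in>topspace X. \<phi> (f x))"

section \<open>Peano continua\<close>

definition peano_continuum :: "'y topology \<Rightarrow> bool" where
  "peano_continuum Y \<longleftrightarrow>
     compact_space Y \<and> connected_space Y \<and> locally_connected_space Y \<and> metrizable_space Y"

section \<open>Constructing unital C*-algebras\<close>

text \<open>
  Additive inverses need not be supplied: \<open>cscale A 0 x = \<zero>\<close> follows from homogeneity of the norm.
\<close>

lemma unital_cstar_algebraI:
  fixes A :: "'a cstar_algebra" (structure)
  assumes cl: "\<zero> \<in> carrier A" "\<one> \<in> carrier A"
      "\<And>x y. \<lbrakk>x \<in> carrier A; y \<in> carrier A\<rbrakk> \<Longrightarrow> x \<oplus> y \<in> carrier A"
      "\<And>x y. \<lbrakk>x \<in> carrier A; y \<in> carrier A\<rbrakk> \<Longrightarrow> x \<otimes> y \<in> carrier A"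
      "\<And>c x. x \<in> carrier A \<Longrightarrow> cscale A c x \<in> carrier A"
      "\<And>x. x \<in> carrier A \<Longrightarrow> cstar A x \<in> carrier A"
    and add: "\<And>x y z. \<lbrakk>x \<in> carrier A; y \<in> carrier A; z \<in> carrier A\<rbrakk> \<Longrightarrow> (x \<oplus> y) \<oplus> z = x \<oplus> (y \<oplus> z)"
      "\<And>x y. \<lbrakk>x \<in> carrier A; y \<in> carrier A\<rbrakk> \<Longrightarrow> x \<oplus> y = y \<oplus> x"
      "\<And>x. x \<in> carrier A \<Longrightarrow> \<zero> \<oplus> x = x"
    and mult: "\<And>x y z. \<lbrakk>x \<in> carrier A; y \<in> carrier A; z \<in> carrier A\<rbrakk> \<Longrightarrow> (x \<otimes> y) \<otimes> z = x \<otimes> (y \<otimes> z)"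
      "\<And>x. x \<in> carrier A \<Longrightarrow> \<one> \<otimes> x = x"
      "\<And>x. x \<in> carrier A \<Longrightarrow> x \<otimes> \<one> = x"
      "\<And>x y z. \<lbrakk>x \<in> carrier A; y \<in> carrier A; z \<in> carrier A\<rbrakk> \<Longrightarrow> (x \<oplus> y) \<otimes> z = x \<otimes> z \<oplus> y \<otimes> z"
      "\<And>x y z. \<lbrakk>x \<in> carrier A; y \<in> carrier A; z \<in> carrier A\<rbrakk> \<Longrightarrow> z \<otimes> (x \<oplus> y) = z \<otimes> x \<oplus> z \<otimes> y"
    and sc: "\<And>c d x. x \<in> carrier A \<Longrightarrow> cscale A (c + d) x = cscale A c x \<oplus> cscale A d x"
      "\<And>c x y. \<lbrakk>x \<in> carrier A; y \<in> carrier A\<rbrakk> \<Longrightarrow> cscale A c (x \<oplus> y) = cscale A c x \<oplus> cscale A c y"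
      "\<And>c d x. x \<in> carrier A \<Longrightarrow> cscale A c (cscale A d x) = cscale A (c * d) x"
      "\<And>x. x \<in> carrier A \<Longrightarrow> cscale A 1 x = x"
      "\<And>c x y. \<lbrakk>x \<in> carrier A; y \<in> carrier A\<rbrakk> \<Longrightarrow> cscale A c x \<otimes> y = cscale A c (x \<otimes> y)"
      "\<And>c x y. \<lbrakk>x \<in> carrier A; y \<in> carrier A\<rbrakk> \<Longrightarrow> x \<otimes> cscale A c y = cscale A c (x \<otimes> y)"
    and st: "\<And>x. x \<in> carrier A \<Longrightarrow> cstar A (cstar A x) = x"
      "\<And>x y. \<lbrakk>x \<in> carrier A; y \<in> carrier A\<rbrakk> \<Longrightarrow> cstar A (x \<oplus> y) = cstar A x \<oplus> cstar A y"
      "\<And>c x. x \<in> carrier A \<Longrightarrow> cstar A (cscale A c x) = cscale A (cnj c) (cstar A x)"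
      "\<And>x y. \<lbrakk>x \<in> carrier A; y \<in> carrier A\<rbrakk> \<Longrightarrow> cstar A (x \<otimes> y) = cstar A y \<otimes> cstar A x"
    and nm: "\<And>x. x \<in> carrier A \<Longrightarrow> 0 \<le> cnorm A x"
      "\<And>x. x \<in> carrier A \<Longrightarrow> cnorm A x = 0 \<longleftrightarrow> x = \<zero>"
      "\<And>x y. \<lbrakk>x \<in> carrier A; y \<in> carrier A\<rbrakk> \<Longrightarrow> cnorm A (x \<oplus> y) \<le> cnorm A x + cnorm A y"
      "\<And>c x. x \<in> carrier A \<Longrightarrow> cnorm A (cscale A c x) = cmod c * cnorm A x"
      "\<And>x y. \<lbrakk>x \<in> carrier A; y \<in> carrier A\<rbrakk> \<Longrightarrow> cnorm A (x \<otimes> y) \<le> cnorm A x * cnorm A y"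
      "\<And>x. x \<in> carrier A \<Longrightarrow> cnorm A (cstar A x \<otimes> x) = (cnorm A x)\<^sup>2"
    and lim: "\<And>\<sigma>. \<lbrakk>\<And>n. \<sigma> n \<in> carrier A;
            \<And>e. e > 0 \<Longrightarrow> \<exists>N. \<forall>m\<ge>N. \<forall>n\<ge>N. cnorm A (\<sigma> m \<oplus> cscale A (-1) (\<sigma> n)) < e\<rbrakk> \<Longrightarrow>
          \<exists>l\<in>carrier A. (\<lambda>n. cnorm A (\<sigma> n \<oplus> cscale A (-1) l)) \<longlonglongrightarrow> 0"
  shows "unital_cstar_algebra A"
proof -
  have z: "cscale A 0 x = \<zero>" if "x \<in> carrier A" for x
  proof -
    have "cnorm A (cscale A 0 x) = 0" using nm(4)[OF that] by simp
    then show ?thesis using nm(2) cl(5) that by blast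
  qed
  have neg: "cscale A (-1) x \<oplus> x = \<zero>" if "x \<in> carrier A" for x
    using sc(1)[OF that, of "-1" 1] z[OF that] sc(4)[OF that] by simp
  have R: "ring A"
  proof (rule ringI)
    show "abelian_group A"
      proof (rule abelian_groupI)
      fix x assume "x \<in> carrier A"
      then show "\<exists>y\<in>carrier A. y \<oplus> x = \<zero>" using neg cl(5) by blast
    qed (use cl add in auto)
    show "monoid A"
      by (rule monoidI) (use cl mult in auto)
  qed (use mult in auto)
  interpret ring A by (rule R)
  have m: "\<ominus> x = cscale A (-1) x" if "x \<in> carrier A" for x
    using neg that cl(5) minus_equality by blast
  have cmp: "\<exists>l\<in>carrier A. (\<lambda>n. cnorm A (\<sigma> n \<ominus> l)) \<longlonglongrightarrow> 0"
    if a: "\<And>n. \<sigma> n \<in> carrier A"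
      and b: "\<And>e. e > 0 \<Longrightarrow> \<exists>N. \<forall>m\<ge>N. \<forall>n\<ge>N. cnorm A (\<sigma> m \<ominus> \<sigma> n) < e" for \<sigma> :: "nat \<Rightarrow> 'a"
  proof -
    have "\<exists>l\<in>carrier A. (\<lambda>n. cnorm A (\<sigma> n \<oplus> cscale A (-1) l)) \<longlonglongrightarrow> 0"
      by (rule lim) (use a b in \<open>simp_all add: a_minus_def m\<close>)
    then show ?thesis by (auto simp: a_minus_def m)
  qed
  show ?thesis
    by (intro unital_cstar_algebra.intro[OF R] unital_cstar_algebra_axioms.intro)
      (fact cl sc st nm cmp)+
qed

lemma (in unital_cstar_algebra) cscale_minus_one: "x \<in> carrier A \<Longrightarrow> cscale A (-1) x = \<ominus> x"
proof -
  assume x: "x \<in> carrier A"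
  have "cnorm A (cscale A 0 x) = 0" using cnorm_cscale[OF x] by simp
  then have "cscale A 0 x = \<zero>" using cnorm_eq_0_iff cscale_closed x by blast
  then have "cscale A (-1) x \<oplus> x = \<zero>"
    using cscale_add_left[OF x, of "-1" 1] cscale_one[OF x] by simp
  then show ?thesis using minus_equality x cscale_closed by force
qed

section \<open>\<open>C(X)\<close> is a unital C*-algebra and \<open>C(f)\<close> a unital *-homomorphism\<close>

lemma cont_alg_norm:
  assumes X: "compact_space X" and \<phi>: "\<phi> \<in> carrier (cont_alg X)"
  shows "x \<in> topspace X \<Longrightarrow> cmod (\<phi> x) \<le> cnorm (cont_alg X) \<phi>"
    and "0 \<le> cnorm (cont_alg X) \<phi>"
    and "\<lbrakk>0 \<le> r; \<And>x. x \<in> topspace X \<Longrightarrow> cmod (\<phi> x) \<le> r\<rbrakk> \<Longrightarrow> cnorm (cont_alg X) \<phi> \<le> r"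
proof -
  have "continuous_map X euclidean \<phi>" using \<phi> by (simp add: cont_alg_def)
  then have "compactin euclidean (\<phi> ` topspace X)"
    using X compact_space_def image_compactin by blast
  then have "bounded (\<phi> ` topspace X)"
    by (simp add: compact_imp_bounded)
  then obtain b where "\<And>x. x \<in> topspace X \<Longrightarrow> cmod (\<phi> x) \<le> b"
    by (auto simp: bounded_iff)
  then have "bdd_above ((\<lambda>x. cmod (\<phi> x)) ` topspace X)"
    by (auto simp: bdd_above_def)
  then have bdd: "bdd_above (insert 0 ((\<lambda>x. cmod (\<phi> x)) ` topspace X))"
    by simp
  show "x \<in> topspace X \<Longrightarrow> cmod (\<phi> x) \<le> cnorm (cont_alg X) \<phi>"
    and "0 \<le> cnorm (cont_alg X) \<phi>"
    by (auto simp: cont_alg_def intro!: cSup_upper bdd)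
  show "\<lbrakk>0 \<le> r; \<And>x. x \<in> topspace X \<Longrightarrow> cmod (\<phi> x) \<le> r\<rbrakk> \<Longrightarrow> cnorm (cont_alg X) \<phi> \<le> r"
    by (auto simp: cont_alg_def intro!: cSup_least)
qed

lemma cont_alg_sel:
  "\<phi> \<in> carrier (cont_alg X) \<longleftrightarrow> \<phi> \<in> extensional (topspace X) \<and> continuous_map X euclidean \<phi>"
  "\<phi> \<otimes>\<^bsub>cont_alg X\<^esub> \<psi> = (\<lambda>x\<in>topspace X. \<phi> x * \<psi> x)"
  "\<one>\<^bsub>cont_alg X\<^esub> = (\<lambda>x\<in>topspace X. 1)"
  "\<zero>\<^bsub>cont_alg X\<^esub> = (\<lambda>x\<in>topspace X. 0)"
  "\<phi> \<oplus>\<^bsub>cont_alg X\<^esub> \<psi> = (\<lambda>x\<in>topspace X. \<phi> x + \<psi> x)"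
  "cscale (cont_alg X) c \<phi> = (\<lambda>x\<in>topspace X. c * \<phi> x)"
  "cstar (cont_alg X) \<phi> = (\<lambda>x\<in>topspace X. cnj (\<phi> x))"
  by (simp_all add: cont_alg_def)

lemma cont_alg_ext:
  "\<lbrakk>\<phi> \<in> carrier (cont_alg X); \<psi> \<in> carrier (cont_alg X); \<And>x. x \<in> topspace X \<Longrightarrow> \<phi> x = \<psi> x\<rbrakk> \<Longrightarrow> \<phi> = \<psi>"
  by (auto simp: cont_alg_sel intro: extensionalityI)

lemma cont_alg_closed:
  "\<zero>\<^bsub>cont_alg X\<^esub> \<in> carrier (cont_alg X)"
  "\<one>\<^bsub>cont_alg X\<^esub> \<in> carrier (cont_alg X)"
  "\<lbrakk>\<phi> \<in> carrier (cont_alg X); \<psi> \<in> carrier (cont_alg X)\<rbrakk> \<Longrightarrow> \<phi> \<oplus>\<^bsub>cont_alg X\<^esub> \<psi> \<in> carrier (cont_alg X)"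
  "\<lbrakk>\<phi> \<in> carrier (cont_alg X); \<psi> \<in> carrier (cont_alg X)\<rbrakk> \<Longrightarrow> \<phi> \<otimes>\<^bsub>cont_alg X\<^esub> \<psi> \<in> carrier (cont_alg X)"
  "\<phi> \<in> carrier (cont_alg X) \<Longrightarrow> cscale (cont_alg X) c \<phi> \<in> carrier (cont_alg X)"
  "\<phi> \<in> carrier (cont_alg X) \<Longrightarrow> cstar (cont_alg X) \<phi> \<in> carrier (cont_alg X)"
proof -
  have r: "continuous_map X euclidean (restrict g (topspace X)) \<longleftrightarrow> continuous_map X euclidean g"
    for g :: "'a \<Rightarrow> complex"
    using continuous_map_eq[of X euclidean g "restrict g (topspace X)"]
      continuous_map_eq[of X euclidean "restrict g (topspace X)" g] by auto
  show "\<zero>\<^bsub>cont_alg X\<^esub> \<in> carrier (cont_alg X)" "\<one>\<^bsub>cont_alg X\<^esub> \<in> carrier (cont_alg X)"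
    by (simp_all add: cont_alg_sel r)
  show "\<lbrakk>\<phi> \<in> carrier (cont_alg X); \<psi> \<in> carrier (cont_alg X)\<rbrakk> \<Longrightarrow> \<phi> \<oplus>\<^bsub>cont_alg X\<^esub> \<psi> \<in> carrier (cont_alg X)"
    "\<lbrakk>\<phi> \<in> carrier (cont_alg X); \<psi> \<in> carrier (cont_alg X)\<rbrakk> \<Longrightarrow> \<phi> \<otimes>\<^bsub>cont_alg X\<^esub> \<psi> \<in> carrier (cont_alg X)"
    "\<phi> \<in> carrier (cont_alg X) \<Longrightarrow> cscale (cont_alg X) c \<phi> \<in> carrier (cont_alg X)"
    "\<phi> \<in> carrier (cont_alg X) \<Longrightarrow> cstar (cont_alg X) \<phi> \<in> carrier (cont_alg X)"
    by (simp_all add: cont_alg_sel r, simp_all add: continuous_map_atin tendsto_add tendsto_mult tendsto_cnj)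
qed

lemma unital_cstar_algebra_cont_alg:
  assumes X: "compact_space X"
  shows "unital_cstar_algebra (cont_alg X)"
proof (rule unital_cstar_algebraI)
  let ?C = "cont_alg X"
  note n = cont_alg_norm[OF X]
  note cl = cont_alg_closed
  show "0 \<le> cnorm ?C \<phi>" if "\<phi> \<in> carrier ?C" for \<phi>
    using n(2)[OF that] .
  show "cnorm ?C \<phi> = 0 \<longleftrightarrow> \<phi> = \<zero>\<^bsub>?C\<^esub>" if a: "\<phi> \<in> carrier ?C" for \<phi>
  proof
    assume z: "cnorm ?C \<phi> = 0"
    show "\<phi> = \<zero>\<^bsub>?C\<^esub>"
    proof (rule cont_alg_ext[OF a cl(1)])
      fix x assume x: "x \<in> topspace X"
      then show "\<phi> x = \<zero>\<^bsub>?C\<^esub> x" using n(1)[OF a x] z by (simp add: cont_alg_sel)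
    qed
  next
    assume "\<phi> = \<zero>\<^bsub>?C\<^esub>"
    then have "cnorm ?C \<phi> \<le> 0" by (intro n(3)[OF a]) (simp_all add: cont_alg_sel)
    then show "cnorm ?C \<phi> = 0" using n(2)[OF a] by simp
  qed
  show "cnorm ?C (\<phi> \<oplus>\<^bsub>?C\<^esub> \<psi>) \<le> cnorm ?C \<phi> + cnorm ?C \<psi>"
    if a: "\<phi> \<in> carrier ?C" and b: "\<psi> \<in> carrier ?C" for \<phi> \<psi>
  proof (rule n(3)[OF cl(3)[OF a b]])
    fix x assume x: "x \<in> topspace X"
    show "cmod ((\<phi> \<oplus>\<^bsub>?C\<^esub> \<psi>) x) \<le> cnorm ?C \<phi> + cnorm ?C \<psi>"
      using n(1)[OF a x] n(1)[OF b x] norm_triangle_ineq[of "\<phi> x" "\<psi> x"] x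
      by (simp add: cont_alg_sel)
  qed (use n(2)[OF a] n(2)[OF b] in simp)
  have le: "cnorm ?C (cscale ?C c \<phi>) \<le> cmod c * cnorm ?C \<phi>"
    if a: "\<phi> \<in> carrier ?C" for c \<phi>
  proof (rule n(3)[OF cl(5)[OF a]])
    fix x assume x: "x \<in> topspace X"
    show "cmod (cscale ?C c \<phi> x) \<le> cmod c * cnorm ?C \<phi>"
      using n(1)[OF a x] x by (simp add: cont_alg_sel norm_mult mult_left_mono)
  qed (use n(2)[OF a] in simp)
  show "cnorm ?C (cscale ?C c \<phi>) = cmod c * cnorm ?C \<phi>" if a: "\<phi> \<in> carrier ?C" for c \<phi>
  proof (cases "c = 0")
    case True
    then show ?thesis using le[OF a, of 0] n(2)[OF cl(5)[OF a], of 0] by simp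
  next
    case False
    have "cscale ?C (inverse c) (cscale ?C c \<phi>) = \<phi>"
      by (rule cont_alg_ext[OF cl(5)[OF cl(5)[OF a]] a]) (simp add: cont_alg_sel False)
    then have "cnorm ?C \<phi> \<le> inverse (cmod c) * cnorm ?C (cscale ?C c \<phi>)"
      using le[OF cl(5)[OF a], of "inverse c" c] by (simp add: norm_inverse)
    then have "cmod c * cnorm ?C \<phi> \<le> cnorm ?C (cscale ?C c \<phi>)"
      using False by (simp add: field_simps)
    then show ?thesis using le[OF a, of c] by simp
  qed
  show M: "cnorm ?C (\<phi> \<otimes>\<^bsub>?C\<^esub> \<psi>) \<le> cnorm ?C \<phi> * cnorm ?C \<psi>"
    if a: "\<phi> \<in> carrier ?C" and b: "\<psi> \<in> carrier ?C" for \<phi> \<psi>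
  proof (rule n(3)[OF cl(4)[OF a b]])
    fix x assume x: "x \<in> topspace X"
    show "cmod ((\<phi> \<otimes>\<^bsub>?C\<^esub> \<psi>) x) \<le> cnorm ?C \<phi> * cnorm ?C \<psi>"
      using n(1)[OF a x] n(1)[OF b x] n(2)[OF a] x
      by (simp add: cont_alg_sel norm_mult mult_mono)
  qed (use n(2)[OF a] n(2)[OF b] in simp)
  show "cnorm ?C (cstar ?C \<phi> \<otimes>\<^bsub>?C\<^esub> \<phi>) = (cnorm ?C \<phi>)\<^sup>2" if a: "\<phi> \<in> carrier ?C" for \<phi>
  proof (rule antisym)
    let ?p = "cstar ?C \<phi> \<otimes>\<^bsub>?C\<^esub> \<phi>"
    have p: "?p \<in> carrier ?C" using cl(4)[OF cl(6)[OF a] a] .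
    have "cnorm ?C (cstar ?C \<phi>) \<le> cnorm ?C \<phi>"
    proof (rule n(3)[OF cl(6)[OF a] n(2)[OF a]])
      fix x assume x: "x \<in> topspace X"
      show "cmod (cstar ?C \<phi> x) \<le> cnorm ?C \<phi>" using n(1)[OF a x] x by (simp add: cont_alg_sel)
    qed
    from order_trans[OF M[OF cl(6)[OF a] a] mult_right_mono[OF this n(2)[OF a]]]
    show "cnorm ?C ?p \<le> (cnorm ?C \<phi>)\<^sup>2" by (simp add: power2_eq_square)
    have "cnorm ?C \<phi> \<le> sqrt (cnorm ?C ?p)"
    proof (rule n(3)[OF a])
      fix x assume x: "x \<in> topspace X"
      have "(cmod (\<phi> x))\<^sup>2 \<le> cnorm ?C ?p"
        using n(1)[OF p x] x by (simp add: cont_alg_sel norm_mult power2_eq_square)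
      then show "cmod (\<phi> x) \<le> sqrt (cnorm ?C ?p)" by (rule real_le_rsqrt)
    qed (use n(2)[OF p] in simp)
    then have "(cnorm ?C \<phi>)\<^sup>2 \<le> (sqrt (cnorm ?C ?p))\<^sup>2"
      by (rule power_mono) (rule n(2)[OF a])
    then show "(cnorm ?C \<phi>)\<^sup>2 \<le> cnorm ?C ?p" using n(2)[OF p] by simp
  qed
  show "\<exists>l\<in>carrier ?C. (\<lambda>k. cnorm ?C (\<sigma> k \<oplus>\<^bsub>?C\<^esub> cscale ?C (-1) l)) \<longlonglongrightarrow> 0"
    if a: "\<And>k. \<sigma> k \<in> carrier ?C"
      and b: "\<And>e. e > 0 \<Longrightarrow> \<exists>N. \<forall>m\<ge>N. \<forall>k\<ge>N. cnorm ?C (\<sigma> m \<oplus>\<^bsub>?C\<^esub> cscale ?C (-1) (\<sigma> k)) < e" for \<sigma>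
  proof -
    have d: "dist (\<sigma> m x) (\<sigma> k x) \<le> cnorm ?C (\<sigma> m \<oplus>\<^bsub>?C\<^esub> cscale ?C (-1) (\<sigma> k))"
      if "x \<in> topspace X" for x m k
      using n(1)[OF cl(3)[OF a cl(5)[OF a]] that, of m "-1" k] that
      by (simp add: cont_alg_sel dist_norm)
    have cu: "\<exists>N. \<forall>m k x. N \<le> m \<longrightarrow> N \<le> k \<longrightarrow> x \<in> topspace X \<longrightarrow> dist (\<sigma> m x) (\<sigma> k x) < e"
      if "e > 0" for e
      using b[OF that] d by (meson order_le_less_trans)
    have cc: "\<forall>\<^sub>F k in sequentially. continuous_map X Met_TC.mtopology (\<sigma> k)"
      using a by (simp add: cont_alg_sel)
    have "Met_TC.mcomplete TYPE(complex)" by (simp add: complete_UNIV)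
    from Met_TC.continuous_map_uniformly_Cauchy_limit[OF this cc cu]
    obtain g where g: "continuous_map X Met_TC.mtopology g"
      and lim: "\<And>e. 0 < e \<Longrightarrow> \<forall>\<^sub>F k in sequentially. \<forall>x\<in>topspace X. dist (\<sigma> k x) (g x) < e"
      by blast
    let ?l = "restrict g (topspace X)"
    have l: "?l \<in> carrier ?C"
      using g by (auto simp: cont_alg_sel intro: continuous_map_eq)
    have "(\<lambda>k. cnorm ?C (\<sigma> k \<oplus>\<^bsub>?C\<^esub> cscale ?C (-1) ?l)) \<longlonglongrightarrow> 0"
    proof (rule LIMSEQ_I)
      fix r :: real assume r: "0 < r"
      obtain N where N: "\<And>k x. N \<le> k \<Longrightarrow> x \<in> topspace X \<Longrightarrow> dist (\<sigma> k x) (g x) < r/2"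
        using lim[of "r/2"] r by (auto simp: eventually_sequentially)
      have "norm (cnorm ?C (\<sigma> k \<oplus>\<^bsub>?C\<^esub> cscale ?C (-1) ?l) - 0) < r" if "k \<ge> N" for k
      proof -
        note q = cl(3)[OF a cl(5)[OF l], of k "-1"]
        have "cnorm ?C (\<sigma> k \<oplus>\<^bsub>?C\<^esub> cscale ?C (-1) ?l) \<le> r/2"
          by (rule n(3)[OF q]) (use r N[OF that] in \<open>auto simp: cont_alg_sel dist_norm intro: less_imp_le\<close>)
        then show ?thesis using n(2)[OF q] r by simp
      qed
      then show "\<exists>N. \<forall>k\<ge>N. norm (cnorm ?C (\<sigma> k \<oplus>\<^bsub>?C\<^esub> cscale ?C (-1) ?l) - 0) < r" by blast
    qed
    then show ?thesis using l by blast
  qed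
qed (simp_all only: cont_alg_closed,
    auto simp: cont_alg_sel algebra_simps restrict_def extensional_def fun_eq_iff)

lemma cont_alg_map_hom:
  assumes "continuous_map X Y f"
  shows "cont_alg_map X f \<in> unital_star_hom (cont_alg Y) (cont_alg X)"
proof -
  have f: "f x \<in> topspace Y" if "x \<in> topspace X" for x
    using assms that by (auto simp: continuous_map_def)
  have "cont_alg_map X f \<phi> \<in> carrier (cont_alg X)" if "\<phi> \<in> carrier (cont_alg Y)" for \<phi>
  proof -
    have "continuous_map X euclidean (\<phi> \<circ> f)"
      using that assms continuous_map_compose by (auto simp: cont_alg_sel)
    then have "continuous_map X euclidean (cont_alg_map X f \<phi>)"
      by (rule continuous_map_eq) (simp add: cont_alg_map_def)
    then show ?thesis by (simp add: cont_alg_sel cont_alg_map_def)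
  qed
  then show ?thesis
    using f by (auto simp: unital_star_hom_def ring_hom_def cont_alg_sel cont_alg_map_def)
qed

section \<open>The choice of type for the test algebras is immaterial\<close>

text \<open>
  A lifting problem against \<open>A\<close> and \<open>B\<close> only involves the closed subalgebras generated by the
  images of \<open>S\<close> and \<open>T\<close> (and by chosen preimages under the surjection).  Their elements
  are values of countably branching trees with leaves in \<open>'s + 't\<close> and nodes carrying an operation
  and a scalar, and such trees can be coded in \<open>nat \<Rightarrow> 's + 't + complex\<close>.
\<close>

subsection \<open>Transporting a closed subalgebra to another type\<close>

definition transport ::
    "'a cstar_algebra \<Rightarrow> 'a set \<Rightarrow> ('a \<Rightarrow> 'u) \<Rightarrow> ('u \<Rightarrow> 'a) \<Rightarrow> 'u cstar_algebra" where
  "transport A C \<phi> \<psi> =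
    \<lparr>carrier = \<phi> ` C,
     monoid.mult = (\<lambda>x y. \<phi> (\<psi> x \<otimes>\<^bsub>A\<^esub> \<psi> y)),
     one = \<phi> \<one>\<^bsub>A\<^esub>,
     zero = \<phi> \<zero>\<^bsub>A\<^esub>,
     add = (\<lambda>x y. \<phi> (\<psi> x \<oplus>\<^bsub>A\<^esub> \<psi> y)),
     cscale = (\<lambda>c x. \<phi> (cscale A c (\<psi> x))),
     cstar = (\<lambda>x. \<phi> (cstar A (\<psi> x))),
     cnorm = (\<lambda>x. cnorm A (\<psi> x))\<rparr>"

locale closed_subalgebra = unital_cstar_algebra A for A :: "'a cstar_algebra" (structure) +
  fixes C :: "'a set" and \<phi> :: "'a \<Rightarrow> 'u" and \<psi> :: "'u \<Rightarrow> 'a"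
  assumes sub: "C \<subseteq> carrier A"
    and inv: "x \<in> C \<Longrightarrow> \<psi> (\<phi> x) = x"
    and C_zero: "\<zero> \<in> C" and C_one: "\<one> \<in> C"
    and C_add: "\<lbrakk>x \<in> C; y \<in> C\<rbrakk> \<Longrightarrow> x \<oplus> y \<in> C"
    and C_mult: "\<lbrakk>x \<in> C; y \<in> C\<rbrakk> \<Longrightarrow> x \<otimes> y \<in> C"
    and C_cscale: "x \<in> C \<Longrightarrow> cscale A c x \<in> C"
    and C_cstar: "x \<in> C \<Longrightarrow> cstar A x \<in> C"
    and C_lim: "\<lbrakk>\<And>n. \<sigma> n \<in> C; \<exists>l\<in>carrier A. (\<lambda>n. cnorm A (\<sigma> n \<ominus> l)) \<longlonglongrightarrow> 0\<rbrakk> \<Longrightarrow>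
          \<exists>l\<in>C. (\<lambda>n. cnorm A (\<sigma> n \<ominus> l)) \<longlonglongrightarrow> 0"
begin

lemma subD: "x \<in> C \<Longrightarrow> x \<in> carrier A"
  using sub by blast

lemma minus_eq: "y \<in> C \<Longrightarrow> x \<oplus> cscale A (-1) y = x \<ominus> y"
  by (simp add: cscale_minus_one subD a_minus_def)

lemma unital_cstar_algebra_transport: "unital_cstar_algebra (transport A C \<phi> \<psi>)"
proof (rule unital_cstar_algebraI)
  let ?T = "transport A C \<phi> \<psi>"
  show "\<exists>l\<in>carrier ?T. (\<lambda>n. cnorm ?T (\<sigma> n \<oplus>\<^bsub>?T\<^esub> cscale ?T (-1) l)) \<longlonglongrightarrow> 0"
    if a: "\<And>n. \<sigma> n \<in> carrier ?T"
      and b: "\<And>e. e > 0 \<Longrightarrow> \<exists>N. \<forall>m\<ge>N. \<forall>n\<ge>N. cnorm ?T (\<sigma> m \<oplus>\<^bsub>?T\<^esub> cscale ?T (-1) (\<sigma> n)) < e" for \<sigma>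
  proof -
    have s: "\<psi> (\<sigma> n) \<in> C" for n using a[of n] by (auto simp: transport_def inv)
    have n: "cnorm ?T (\<phi> x \<oplus>\<^bsub>?T\<^esub> cscale ?T (-1) (\<phi> y)) = cnorm A (x \<ominus> y)"
      if "x \<in> C" "y \<in> C" for x y
      using that by (simp add: transport_def inv C_add C_cscale minus_eq[symmetric])
    have \<phi>\<psi>: "\<phi> (\<psi> (\<sigma> n)) = \<sigma> n" for n using a[of n] by (auto simp: transport_def inv)
    have "\<exists>l\<in>carrier A. (\<lambda>n. cnorm A (\<psi> (\<sigma> n) \<ominus> l)) \<longlonglongrightarrow> 0"
    proof (rule complete)
      show "\<psi> (\<sigma> n) \<in> carrier A" for n using s subD by blast
      show "\<exists>N. \<forall>m\<ge>N. \<forall>k\<ge>N. cnorm A (\<psi> (\<sigma> m) \<ominus> \<psi> (\<sigma> k)) < e" if "e > 0" for e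
        using b[OF that] n[OF s s] by (simp add: \<phi>\<psi>)
    qed
    from C_lim[OF s this] obtain l where l: "l \<in> C" "(\<lambda>n. cnorm A (\<psi> (\<sigma> n) \<ominus> l)) \<longlonglongrightarrow> 0" by blast
    have "(\<lambda>n. cnorm ?T (\<sigma> n \<oplus>\<^bsub>?T\<^esub> cscale ?T (-1) (\<phi> l))) \<longlonglongrightarrow> 0"
      using l(2) n[OF s l(1)] by (simp add: \<phi>\<psi>)
    moreover have "\<phi> l \<in> carrier ?T" using l(1) by (simp add: transport_def)
    ultimately show ?thesis by blast
  qed
  have "\<phi> x = \<phi> \<zero> \<longleftrightarrow> x = \<zero>" if "x \<in> C" for x
    using that inv C_zero by metis
  then show "cnorm ?T x = 0 \<longleftrightarrow> x = \<zero>\<^bsub>?T\<^esub>" if "x \<in> carrier ?T" for x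
    using that by (auto simp: transport_def inv cnorm_eq_0_iff subD)
qed (auto simp: transport_def inv C_zero C_one C_add C_mult C_cscale C_cstar subD
      a_assoc m_assoc l_distr r_distr cscale_add_left cscale_add_right cscale_cscale cscale_one
      cscale_mult_left cscale_mult_right cstar_cstar cstar_add cstar_cscale cstar_mult
      cnorm_nonneg cnorm_triangle cnorm_cscale cnorm_mult cstar_identity
      intro!: arg_cong[where f = \<phi>] a_comm)

lemma hom_into_transport:
  assumes "u \<in> unital_star_hom S A" and "\<And>s. s \<in> carrier S \<Longrightarrow> u s \<in> C"
  shows "(\<lambda>s. \<phi> (u s)) \<in> unital_star_hom S (transport A C \<phi> \<psi>)"
  using assms by (auto simp: unital_star_hom_def ring_hom_def transport_def inv)

lemma hom_from_transport: "\<psi> \<in> unital_star_hom (transport A C \<phi> \<psi>) A"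
  by (auto simp: unital_star_hom_def ring_hom_def transport_def inv subD
      C_one C_add C_mult C_cscale C_cstar)

end

lemma unital_star_hom_comp:
  assumes "h \<in> unital_star_hom A B" "k \<in> unital_star_hom B D"
  shows "(\<lambda>x. k (h x)) \<in> unital_star_hom A D"
  using assms by (auto simp: unital_star_hom_def ring_hom_def Pi_iff)

lemma unital_star_hom_closed: "\<lbrakk>h \<in> unital_star_hom A B; x \<in> carrier A\<rbrakk> \<Longrightarrow> h x \<in> carrier B"
  by (auto simp: unital_star_hom_def ring_hom_def)

subsection \<open>Coding trees\<close>

datatype 'z ctree = Leaf 'z | Node nat complex "nat \<Rightarrow> 'z ctree"

primrec tree_labels :: "'z ctree \<Rightarrow> nat list \<Rightarrow> 'z + nat \<times> complex" where
  "tree_labels (Leaf z) = (\<lambda>_. Inl z)"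
| "tree_labels (Node k c f) =
     (\<lambda>q. case q of [] \<Rightarrow> Inr (k, c) | n # q' \<Rightarrow> tree_labels (f n) q')"

lemma tree_labels_inject: "tree_labels t = tree_labels t' \<Longrightarrow> t = t'"
proof (induction t arbitrary: t')
  case (Leaf z)
  then show ?case by (cases t') (auto dest: fun_cong[where x = "[]"])
next
  case (Node k c f)
  show ?case
  proof (cases t')
    case (Leaf z)
    then show ?thesis using Node.prems by (auto dest: fun_cong[where x = "[]"])
  next
    case N: (Node k' c' f')
    have "k = k' \<and> c = c'" using fun_cong[OF Node.prems, of "[]"] N by simp
    moreover have "f n = f' n" for n
    proof (rule Node.IH)
      show "f n \<in> range f" by simp
      show "tree_labels (f n) = tree_labels (f' n)"
      proof
        fix q show "tree_labels (f n) q = tree_labels (f' n) q"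
          using fun_cong[OF Node.prems, of "n # q"] N by simp
      qed
    qed
    ultimately show ?thesis using N by auto
  qed
qed

fun label_code :: "('s + 't) + nat \<times> complex \<Rightarrow> nat \<Rightarrow> 's + 't + complex" where
  "label_code (Inl (Inl s)) = (\<lambda>_. Inl s)"
| "label_code (Inl (Inr t)) = (\<lambda>_. Inr (Inl t))"
| "label_code (Inr (k, c)) = (\<lambda>n. Inr (Inr (if n = 0 then c else of_nat k)))"

lemma label_code_inject: "label_code x = label_code y \<Longrightarrow> x = y"
  by (cases x rule: label_code.cases; cases y rule: label_code.cases)
    (auto dest: fun_cong[where x = 0] fun_cong[where x = 1])

definition tree_code :: "('s + 't) ctree \<Rightarrow> nat \<Rightarrow> 's + 't + complex" where
  "tree_code t = (\<lambda>n. case from_nat n of (q, m) \<Rightarrow> label_code (tree_labels t q) m)"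

lemma inj_tree_code: "inj tree_code"
proof (rule injI)
  fix t t' :: "('s + 't) ctree" assume eq: "tree_code t = tree_code t'"
  have "label_code (tree_labels t q) n = label_code (tree_labels t' q) n" for q n
    using fun_cong[OF eq, of "to_nat (q, n)"] by (simp add: tree_code_def)
  then have "label_code (tree_labels t q) = label_code (tree_labels t' q)" for q by blast
  then show "t = t'" by (rule tree_labels_inject[OF ext[OF label_code_inject]])
qed

lemma tree_values_coded:
  fixes e :: "('s + 't) ctree \<Rightarrow> 'a"
  shows "\<exists>(\<phi> :: 'a \<Rightarrow> nat \<Rightarrow> 's + 't + complex) \<psi>. \<forall>x\<in>range e. \<psi> (\<phi> x) = x"
proof (intro exI ballI)
  fix x assume "x \<in> range e"
  then show "(\<lambda>w. e (the_inv tree_code w)) (tree_code (inv_into UNIV e x)) = x"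
    by (simp add: the_inv_f_f[OF inj_tree_code] f_inv_into_f)
qed

subsection \<open>Evaluating trees in a lifting problem\<close>

definition lim_in :: "'a cstar_algebra \<Rightarrow> (nat \<Rightarrow> 'a) \<Rightarrow> 'a" where
  "lim_in A \<sigma> = (if \<exists>l\<in>carrier A. (\<lambda>n. cnorm A (\<sigma> n \<ominus>\<^bsub>A\<^esub> l)) \<longlonglongrightarrow> 0
     then SOME l. l \<in> carrier A \<and> (\<lambda>n. cnorm A (\<sigma> n \<ominus>\<^bsub>A\<^esub> l)) \<longlonglongrightarrow> 0 else \<zero>\<^bsub>A\<^esub>)"

lemma lim_in:
  assumes "\<exists>l\<in>carrier A. (\<lambda>n. cnorm A (\<sigma> n \<ominus>\<^bsub>A\<^esub> l)) \<longlonglongrightarrow> 0"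
  shows "lim_in A \<sigma> \<in> carrier A \<and> (\<lambda>n. cnorm A (\<sigma> n \<ominus>\<^bsub>A\<^esub> lim_in A \<sigma>)) \<longlonglongrightarrow> 0"
proof -
  have "\<exists>l. l \<in> carrier A \<and> (\<lambda>n. cnorm A (\<sigma> n \<ominus>\<^bsub>A\<^esub> l)) \<longlonglongrightarrow> 0" using assms by blast
  from someI_ex[OF this] show ?thesis using assms by (simp add: lim_in_def)
qed

definition cstar_op :: "'a cstar_algebra \<Rightarrow> nat \<Rightarrow> complex \<Rightarrow> (nat \<Rightarrow> 'a) \<Rightarrow> 'a" where
  "cstar_op A k c w =
    (if k = 0 then \<one>\<^bsub>A\<^esub> else if k = 1 then w 0 \<oplus>\<^bsub>A\<^esub> w 1 else if k = 2 then w 0 \<otimes>\<^bsub>A\<^esub> w 1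
     else if k = 3 then cscale A c (w 0) else if k = 4 then cstar A (w 0)
     else if k = 5 then lim_in A w else \<zero>\<^bsub>A\<^esub>)"

lemma cstar_op_closed:
  assumes "unital_cstar_algebra A" and "\<And>n. w n \<in> carrier A"
  shows "cstar_op A k c w \<in> carrier A"
proof -
  interpret unital_cstar_algebra A by fact
  have "lim_in A w \<in> carrier A"
    using lim_in[of A w] by (cases "\<exists>l\<in>carrier A. (\<lambda>n. cnorm A (w n \<ominus>\<^bsub>A\<^esub> l)) \<longlonglongrightarrow> 0")
      (auto simp: lim_in_def)
  then show ?thesis
    using assms(2) by (simp add: cstar_op_def cscale_closed cstar_closed)
qed

lemma closed_subalgebraI:
  assumes A: "unital_cstar_algebra A" and sub: "C \<subseteq> carrier A"
    and op: "\<And>k c w. (\<And>n. w n \<in> C) \<Longrightarrow> cstar_op A k c w \<in> C" and ne: "x0 \<in> C"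
    and inv: "\<And>x. x \<in> C \<Longrightarrow> \<psi> (\<phi> x) = x"
  shows "closed_subalgebra A C \<phi> \<psi>"
proof -
  have op2: "cstar_op A k c (\<lambda>n. if n = 0 then x else y) \<in> C" if "x \<in> C" "y \<in> C" for k c x y
    using that by (intro op) simp
  show ?thesis
  proof (intro closed_subalgebra.intro[OF A] closed_subalgebra_axioms.intro)
    show "C \<subseteq> carrier A" "\<And>x. x \<in> C \<Longrightarrow> \<psi> (\<phi> x) = x" by (fact sub inv)+
    show "\<zero>\<^bsub>A\<^esub> \<in> C" using op2[OF ne ne, of 6] by (simp add: cstar_op_def)
    show "\<one>\<^bsub>A\<^esub> \<in> C" using op2[OF ne ne, of 0] by (simp add: cstar_op_def)
    show "x \<oplus>\<^bsub>A\<^esub> y \<in> C" if "x \<in> C" "y \<in> C" for x y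
      using op2[OF that, of 1] by (simp add: cstar_op_def)
    show "x \<otimes>\<^bsub>A\<^esub> y \<in> C" if "x \<in> C" "y \<in> C" for x y
      using op2[OF that, of 2] by (simp add: cstar_op_def)
    show "cscale A c x \<in> C" if "x \<in> C" for c x
      using op2[OF that that, of 3 c] by (simp add: cstar_op_def)
    show "cstar A x \<in> C" if "x \<in> C" for x
      using op2[OF that that, of 4] by (simp add: cstar_op_def)
    show "\<exists>l\<in>C. (\<lambda>n. cnorm A (\<sigma> n \<ominus>\<^bsub>A\<^esub> l)) \<longlonglongrightarrow> 0"
      if "\<And>n. \<sigma> n \<in> C" "\<exists>l\<in>carrier A. (\<lambda>n. cnorm A (\<sigma> n \<ominus>\<^bsub>A\<^esub> l)) \<longlonglongrightarrow> 0" for \<sigma>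
      using op[of \<sigma> 5 0] that(1) lim_in[OF that(2)] by (auto simp: cstar_op_def)
  qed
qed

text \<open>
  A tree is evaluated in \<open>A \<times> B\<close>; operations 7 and 8 pass between the components
  along a set-theoretic section \<open>\<sigma>\<close> of \<open>p\<close> and along \<open>p\<close> itself.
\<close>

definition pair_op ::
    "'a cstar_algebra \<Rightarrow> 'b cstar_algebra \<Rightarrow> ('a \<Rightarrow> 'b) \<Rightarrow> ('b \<Rightarrow> 'a) \<Rightarrow>
     nat \<Rightarrow> complex \<Rightarrow> (nat \<Rightarrow> 'a \<times> 'b) \<Rightarrow> 'a \<times> 'b" where
  "pair_op A B p \<sigma> k c w =
    (if k = 7 then (\<sigma> (snd (w 0)), snd (w 0))
     else if k = 8 then (fst (w 0), p (fst (w 0)))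
     else (cstar_op A k c (\<lambda>n. fst (w n)), cstar_op B k c (\<lambda>n. snd (w n))))"

primrec ctree_eval ::
    "'a cstar_algebra \<Rightarrow> 'b cstar_algebra \<Rightarrow> ('a \<Rightarrow> 'b) \<Rightarrow> ('b \<Rightarrow> 'a) \<Rightarrow> ('z \<Rightarrow> 'a \<times> 'b) \<Rightarrow>
     'z ctree \<Rightarrow> 'a \<times> 'b" where
  "ctree_eval A B p \<sigma> v (Leaf z) = v z"
| "ctree_eval A B p \<sigma> v (Node k c f) = pair_op A B p \<sigma> k c (\<lambda>n. ctree_eval A B p \<sigma> v (f n))"

theorem doubly_projective_lifts:
  fixes S :: "'s cstar_algebra" and T :: "'t cstar_algebra"
    and A :: "'a cstar_algebra" and B :: "'b cstar_algebra"
  assumes dp: "doubly_projective S T i"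
    and A: "unital_cstar_algebra A" and B: "unital_cstar_algebra B"
  shows "lifts_against S T i A B"
  unfolding lifts_against_def
proof (intro allI impI)
  fix u g p
  assume u: "u \<in> unital_star_hom S A" and g: "g \<in> unital_star_hom T B"
    and p: "p \<in> unital_star_hom A B" and surj: "p ` carrier A = carrier B"
    and comm: "\<forall>s\<in>carrier S. g (i s) = p (u s)"
  interpret A: unital_cstar_algebra A by (rule A)
  interpret B: unital_cstar_algebra B by (rule B)
  define \<sigma> where "\<sigma> = inv_into (carrier A) p"
  have \<sigma>: "\<sigma> b \<in> carrier A" "p (\<sigma> b) = b" if "b \<in> carrier B" for b
    using that surj by (auto simp: \<sigma>_def inv_into_into f_inv_into_f)
  define v :: "'s + 't \<Rightarrow> 'a \<times> 'b" where
    "v = case_sum (\<lambda>s. (if s \<in> carrier S then u s else \<zero>\<^bsub>A\<^esub>, \<zero>\<^bsub>B\<^esub>))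
                  (\<lambda>t. (\<zero>\<^bsub>A\<^esub>, if t \<in> carrier T then g t else \<zero>\<^bsub>B\<^esub>))"
  define ev where "ev = ctree_eval A B p \<sigma> v"
  have ev_Node: "ev (Node k c f) = pair_op A B p \<sigma> k c (\<lambda>n. ev (f n))" for k c f
    by (simp add: ev_def)
  define eA where "eA = (\<lambda>t. fst (ev t))"
  define eB where "eB = (\<lambda>t. snd (ev t))"
  have ev_in: "eA t \<in> carrier A \<and> eB t \<in> carrier B" for t
  proof (induction t)
    case (Leaf z)
    then show ?case
      using u g by (cases z) (auto simp: eA_def eB_def ev_def v_def unital_star_hom_closed)
  next
    case (Node k c f)
    then show ?case
      using \<sigma>(1) p
      by (auto simp: eA_def eB_def ev_Node pair_op_def unital_star_hom_closed
          intro!: cstar_op_closed A B)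
  qed
  have opA: "cstar_op A k c w \<in> range eA" if w: "\<And>n. w n \<in> range eA" for k c w
  proof (cases "k < 7")
    case True
    obtain f where "w = (\<lambda>n. eA (f n))" using w by (metis (no_types) f_inv_into_f)
    then have "cstar_op A k c w = eA (Node k c f)"
      using True by (simp add: eA_def ev_Node pair_op_def)
    then show ?thesis by blast
  next
    case False
    then have "cstar_op A k c w = eA (Node 6 c (\<lambda>_. undefined))"
      by (simp add: eA_def ev_Node pair_op_def cstar_op_def)
    then show ?thesis by blast
  qed
  have opB: "cstar_op B k c w \<in> range eB" if w: "\<And>n. w n \<in> range eB" for k c w
  proof (cases "k < 7")
    case True
    obtain f where "w = (\<lambda>n. eB (f n))" using w by (metis (no_types) f_inv_into_f)
    then have "cstar_op B k c w = eB (Node k c f)"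
      using True by (simp add: eB_def ev_Node pair_op_def)
    then show ?thesis by blast
  next
    case False
    then have "cstar_op B k c w = eB (Node 6 c (\<lambda>_. undefined))"
      by (simp add: eB_def ev_Node pair_op_def cstar_op_def)
    then show ?thesis by blast
  qed
  have p_range: "p a \<in> range eB" if "a \<in> range eA" for a
  proof -
    obtain t where "a = eA t" using \<open>a \<in> range eA\<close> by blast
    then have "p a = eB (Node 8 0 (\<lambda>_. t))" by (simp add: eA_def eB_def ev_Node pair_op_def)
    then show ?thesis by blast
  qed
  have \<sigma>_range: "\<sigma> b \<in> range eA" if "b \<in> range eB" for b
  proof -
    obtain t where "b = eB t" using \<open>b \<in> range eB\<close> by blast
    then have "\<sigma> b = eA (Node 7 0 (\<lambda>_. t))" by (simp add: eA_def eB_def ev_Node pair_op_def)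
    then show ?thesis by blast
  qed
  have u_range: "u s \<in> range eA" if "s \<in> carrier S" for s
    using that by (intro range_eqI[where x = "Leaf (Inl s)"]) (simp add: eA_def ev_def v_def)
  have g_range: "g t \<in> range eB" if "t \<in> carrier T" for t
    using that by (intro range_eqI[where x = "Leaf (Inr t)"]) (simp add: eB_def ev_def v_def)
  obtain \<phi>A :: "'a \<Rightarrow> nat \<Rightarrow> 's + 't + complex" and \<psi>A
    where "\<forall>x\<in>range eA. \<psi>A (\<phi>A x) = x" using tree_values_coded[of eA] by (elim exE)
  then have cA: "\<psi>A (\<phi>A x) = x" if "x \<in> range eA" for x using that by (rule bspec)
  obtain \<phi>B :: "'b \<Rightarrow> nat \<Rightarrow> 's + 't + complex" and \<psi>B
    where "\<forall>x\<in>range eB. \<psi>B (\<phi>B x) = x" using tree_values_coded[of eB] by (elim exE)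
  then have cB: "\<psi>B (\<phi>B x) = x" if "x \<in> range eB" for x using that by (rule bspec)
  interpret CA: closed_subalgebra A "range eA" \<phi>A \<psi>A
    by (rule closed_subalgebraI[OF A]) (use ev_in opA cA in auto)
  interpret CB: closed_subalgebra B "range eB" \<phi>B \<psi>B
    by (rule closed_subalgebraI[OF B]) (use ev_in opB cB in auto)
  let ?A = "transport A (range eA) \<phi>A \<psi>A" and ?B = "transport B (range eB) \<phi>B \<psi>B"
  have car: "carrier ?A = \<phi>A ` range eA" "carrier ?B = \<phi>B ` range eB"
    by (simp_all add: transport_def)
  have \<psi>A: "\<psi>A x \<in> range eA" if "x \<in> carrier ?A" for x
    using that cA by (auto simp: car)
  have p': "(\<lambda>x. \<phi>B (p (\<psi>A x))) \<in> unital_star_hom ?A ?B"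
    by (rule CB.hom_into_transport[OF unital_star_hom_comp[OF CA.hom_from_transport p]])
      (rule p_range[OF \<psi>A])
  have surj': "(\<lambda>x. \<phi>B (p (\<psi>A x))) ` carrier ?A = carrier ?B"
  proof
    show "(\<lambda>x. \<phi>B (p (\<psi>A x))) ` carrier ?A \<subseteq> carrier ?B"
      by (rule image_subsetI) (rule unital_star_hom_closed[OF p'])
    show "carrier ?B \<subseteq> (\<lambda>x. \<phi>B (p (\<psi>A x))) ` carrier ?A"
    proof
      fix y assume "y \<in> carrier ?B"
      then obtain b where b: "b \<in> range eB" "y = \<phi>B b" by (auto simp: car)
      then have "y = \<phi>B (p (\<psi>A (\<phi>A (\<sigma> b))))"
        using cA[OF \<sigma>_range[OF b(1)]] \<sigma>(2)[OF CB.subD[OF b(1)]] by simp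
      moreover have "\<phi>A (\<sigma> b) \<in> carrier ?A" using \<sigma>_range[OF b(1)] by (simp add: car)
      ultimately show "y \<in> (\<lambda>x. \<phi>B (p (\<psi>A x))) ` carrier ?A" by blast
    qed
  qed
  have comm': "\<forall>s\<in>carrier S. \<phi>B (g (i s)) = \<phi>B (p (\<psi>A (\<phi>A (u s))))"
    using comm cA[OF u_range] by simp
  have "lifts_against S T i ?A ?B"
    using dp CA.unital_cstar_algebra_transport CB.unital_cstar_algebra_transport
    unfolding doubly_projective_def by blast
  then have "\<exists>h \<in> unital_star_hom T ?A.
      (\<forall>s\<in>carrier S. \<phi>A (u s) = h (i s)) \<and> (\<forall>t\<in>carrier T. \<phi>B (g t) = \<phi>B (p (\<psi>A (h t))))"
    unfolding lifts_against_def
    by (elim allE[where x = "\<lambda>s. \<phi>A (u s)"] allE[where x = "\<lambda>t. \<phi>B (g t)"]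
          allE[where x = "\<lambda>x. \<phi>B (p (\<psi>A x))"] impE)
      (assumption | rule CA.hom_into_transport[OF u u_range] CB.hom_into_transport[OF g g_range]
        p' surj' comm')+
  then obtain h where h: "h \<in> unital_star_hom T ?A"
    and h1: "\<And>s. s \<in> carrier S \<Longrightarrow> \<phi>A (u s) = h (i s)"
    and h2: "\<And>t. t \<in> carrier T \<Longrightarrow> \<phi>B (g t) = \<phi>B (p (\<psi>A (h t)))"
    by blast
  show "\<exists>h\<in>unital_star_hom T A.
      (\<forall>s\<in>carrier S. u s = h (i s)) \<and> (\<forall>t\<in>carrier T. g t = p (h t))"
  proof (intro bexI conjI ballI)
    show "(\<lambda>t. \<psi>A (h t)) \<in> unital_star_hom T A"
      by (rule unital_star_hom_comp[OF h CA.hom_from_transport])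
    show "u s = \<psi>A (h (i s))" if "s \<in> carrier S" for s
      using h1[OF that] cA[OF u_range[OF that]] by simp
    show "g t = p (\<psi>A (h t))" if t: "t \<in> carrier T" for t
      using arg_cong[OF h2[OF t], of \<psi>B] cB[OF g_range[OF t]]
        cB[OF p_range[OF \<psi>A[OF unital_star_hom_closed[OF h t]]]] by simp
  qed
qed

end

theory Submission
  imports Defs
begin

text \<open>
  Suppose \<open>f x0 = f x1 = y0\<close> with \<open>x0 \<noteq> x1\<close>.  Evaluation at \<open>y0\<close> maps \<open>C(Y, M\<^sub>2)\<close> onto \<open>M\<^sub>2\<close>, and
  \<open>u \<phi> y = diag (\<phi> y, \<phi> y0)\<close> lifts \<open>\<phi> \<mapsto> \<phi> y0\<close>, which extends along \<open>C(f)\<close> to \<open>g t = W diag (t x0, t x1) W\<^sup>*\<close>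
  for every unitary \<open>W\<close>.  The values of a lift \<open>h\<close> of \<open>g\<close> over \<open>u\<close> commute with \<open>diag (\<phi> y, \<phi> y0)\<close> for
  all \<open>\<phi>\<close>, so \<open>h t y\<close> is diagonal for \<open>y \<noteq> y0\<close>.  As \<open>y0\<close> is not isolated, \<open>g t = h t y0\<close> is diagonal too.
  Taking for \<open>W\<close> the rotation by 45 degrees and \<open>t\<close> separating \<open>x0\<close> from \<open>x1\<close>, this is a contradiction.
\<close>

section \<open>Composition of bounded operators\<close>

lemma blinfun_compose_assoc: "(R o\<^sub>L S) o\<^sub>L T = R o\<^sub>L (S o\<^sub>L T)"
  by (rule blinfun_eqI) simp

lemma blinfun_compose_id: "id_blinfun o\<^sub>L T = T" "T o\<^sub>L id_blinfun = T"
  by (rule blinfun_eqI, simp)+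

section \<open>Adjoints\<close>

text \<open>The adjoint is taken for the real inner product. On
  \<open>complex \<times> complex\<close> this product is the real part of the Hermitian one, so for
  complex-linear operators \<open>adj\<close> is the conjugate transpose, as \<open>adj_mat2\<close>
  shows on matrices.\<close>

definition adj :: "('a::euclidean_space \<Rightarrow>\<^sub>L 'a) \<Rightarrow> 'a \<Rightarrow>\<^sub>L 'a" where
  "adj T = Blinfun (adjoint (blinfun_apply T))"

lemma inner_adj:
  fixes T :: "'a::euclidean_space \<Rightarrow>\<^sub>L 'a"
  shows "x \<bullet> adj T y = T x \<bullet> y"
proof -
  have l: "linear (blinfun_apply T)"
    by (simp add: blinfun.bounded_linear_right bounded_linear.linear)
  then have "bounded_linear (adjoint (blinfun_apply T))"
    by (simp add: adjoint_linear linear_conv_bounded_linear[symmetric])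
  then show ?thesis by (simp add: adj_def bounded_linear_Blinfun_apply adjoint_works[OF l])
qed

text \<open>The inner product is nondegenerate. The algebraic rules for \<open>adj\<close> are
  reduced through this to a comparison of inner products.\<close>

lemma adj_unique:
  fixes S T :: "'a::euclidean_space \<Rightarrow>\<^sub>L 'a"
  assumes "\<And>x y. x \<bullet> S y = T x \<bullet> y"
  shows "adj T = S"
proof (rule blinfun_eqI)
  fix y
  have "\<forall>x. x \<bullet> adj T y = x \<bullet> S y" by (simp add: inner_adj assms)
  then show "adj T y = S y" by (simp only: vector_eq_ldot)
qed

lemma adj_adj: "adj (adj T) = T"
  by (rule adj_unique) (subst (1 2) inner_commute, simp add: inner_adj)

lemma adj_add: "adj (S + T) = adj S + adj T"
  by (rule adj_unique) (simp add: inner_adj blinfun.add_left inner_add_left inner_add_right)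

lemma adj_scaleR: "adj (r *\<^sub>R T) = r *\<^sub>R adj T"
  by (rule adj_unique) (simp add: inner_adj blinfun.scaleR_left)

lemma adj_compose: "adj (S o\<^sub>L T) = adj T o\<^sub>L adj S"
  by (rule adj_unique) (simp add: inner_adj)

text \<open>The square of the norm of \<open>T x\<close> is the inner product of \<open>x\<close>
  with \<open>(adj T o\<^sub>L T) x\<close>, to which Cauchy-Schwarz applies. This is the nontrivial
  half of the C*-identity.\<close>

lemma norm_sq_le_adj: "(norm T)\<^sup>2 \<le> norm (adj T o\<^sub>L T)"
proof -
  have "norm T \<le> sqrt (norm (adj T o\<^sub>L T))"
  proof (rule norm_blinfun_bound)
    fix x
    have "(norm (T x))\<^sup>2 = x \<bullet> (adj T o\<^sub>L T) x"
      by (simp add: inner_adj power2_norm_eq_inner)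
    also have "\<dots> \<le> norm x * norm ((adj T o\<^sub>L T) x)" by (rule norm_cauchy_schwarz)
    also have "\<dots> \<le> norm x * (norm (adj T o\<^sub>L T) * norm x)"
      by (intro mult_left_mono norm_blinfun norm_ge_zero)
    finally have "(norm (T x))\<^sup>2 \<le> norm (adj T o\<^sub>L T) * (norm x)\<^sup>2"
      by (simp add: power2_eq_square mult_ac)
    from real_le_rsqrt[OF this]
    show "norm (T x) \<le> sqrt (norm (adj T o\<^sub>L T)) * norm x" by (simp add: real_sqrt_mult)
  qed simp
  from power_mono[OF this norm_ge_zero, of 2] show ?thesis by simp
qed

text \<open>Submultiplicativity turns \<open>norm_sq_le_adj\<close> into a bound by
  \<open>norm (adj T) * norm T\<close>, and one factor \<open>norm T\<close> cancels. Applied to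
  \<open>adj T\<close> as well, this makes \<open>adj\<close> isometric.\<close>

lemma norm_le_norm_adj: "norm T \<le> norm (adj T)"
proof -
  have "(norm T)\<^sup>2 \<le> norm (adj T) * norm T"
    using norm_sq_le_adj norm_blinfun_compose order_trans by blast
  then show ?thesis by (cases "T = 0") (auto simp: power2_eq_square)
qed

lemma norm_adj: "norm (adj T) = norm T"
  using norm_le_norm_adj[of T] norm_le_norm_adj[of "adj T"] by (simp add: adj_adj)

lemma norm_adj_compose: "norm (adj T o\<^sub>L T) = (norm T)\<^sup>2"
  using norm_sq_le_adj[of T] norm_blinfun_compose[of "adj T" T]
  by (simp add: norm_adj power2_eq_square)

lemma bounded_linear_adj: "bounded_linear adj"
  by (rule bounded_linear_intro[where K = 1]) (simp_all add: adj_add adj_scaleR norm_adj)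

section \<open>Two by two complex matrices\<close>

text \<open>Matrices are represented as operators on the complex plane squared, so that
  \<open>norm\<close> is the operator norm, for which the C*-identity holds, and the type is
  complete.\<close>

type_synonym op2 = "(complex \<times> complex) \<Rightarrow>\<^sub>L (complex \<times> complex)"

definition mat2 :: "complex \<Rightarrow> complex \<Rightarrow> complex \<Rightarrow> complex \<Rightarrow> op2" where
  "mat2 a b c d = Blinfun (\<lambda>v. (a * fst v + b * snd v, c * fst v + d * snd v))"

lemma mat2_apply: "mat2 a b c d v = (a * fst v + b * snd v, c * fst v + d * snd v)"
proof -
  have "bounded_linear (\<lambda>v. (a * fst v + b * snd v, c * fst v + d * snd v))"
    by (intro bounded_linear_Pair bounded_linear_add bounded_linear_const_mult
        bounded_linear_fst bounded_linear_snd)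
  then show ?thesis by (simp add: mat2_def bounded_linear_Blinfun_apply)
qed

lemma mat2_eq_iff:
  "mat2 a b c d = mat2 a' b' c' d' \<longleftrightarrow> a = a' \<and> b = b' \<and> c = c' \<and> d = d'"
proof
  assume eq: "mat2 a b c d = mat2 a' b' c' d'"
  show "a = a' \<and> b = b' \<and> c = c' \<and> d = d'"
    using arg_cong[OF eq, of "\<lambda>T. T (1, 0)"] arg_cong[OF eq, of "\<lambda>T. T (0, 1)"]
    by (simp add: mat2_apply)
qed simp

lemma mat2_ops:
  "mat2 a b c d o\<^sub>L mat2 a' b' c' d' =
     mat2 (a * a' + b * c') (a * b' + b * d') (c * a' + d * c') (c * b' + d * d')"
  "mat2 a b c d + mat2 a' b' c' d' = mat2 (a + a') (b + b') (c + c') (d + d')"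
  "mat2 1 0 0 1 = id_blinfun"
  by (rule blinfun_eqI, simp add: mat2_apply blinfun.add_left prod_eq_iff algebra_simps)+

lemma adj_mat2: "adj (mat2 a b c d) = mat2 (cnj a) (cnj c) (cnj b) (cnj d)"
  by (rule adj_unique) (simp add: mat2_apply inner_prod_def inner_complex_def algebra_simps)

text \<open>Since \<open>op2\<close> is only a real vector space, multiplication by a complex number
  is expressed as composition with this multiple of the identity.\<close>

definition scalar_op :: "complex \<Rightarrow> op2" where
  "scalar_op c = mat2 c 0 0 c"

lemma scalar_op_simps:
  "scalar_op (c + d) = scalar_op c + scalar_op d"
  "scalar_op c o\<^sub>L scalar_op d = scalar_op (c * d)"
  "scalar_op 1 = id_blinfun"
  "adj (scalar_op c) = scalar_op (cnj c)"
  by (simp_all add: scalar_op_def mat2_ops adj_mat2)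

lemma scalar_op_apply: "scalar_op c v = (c * fst v, c * snd v)"
  by (simp add: scalar_op_def mat2_apply)

text \<open>\<open>scalar_op c\<close> multiplies the norm of every vector by exactly
  \<open>cmod c\<close>.\<close>

lemma norm_scalar_op_le: "norm (scalar_op c o\<^sub>L T) \<le> cmod c * norm T"
proof (rule norm_blinfun_bound)
  fix v
  have "norm (scalar_op c w) = cmod c * norm w" for w
    by (simp add: scalar_op_apply norm_prod_def norm_mult power_mult_distrib real_sqrt_mult
        flip: distrib_left)
  then show "norm ((scalar_op c o\<^sub>L T) v) \<le> cmod c * norm T * norm v"
    using norm_blinfun[of T v] by (simp add: mult_left_mono mult.assoc)
qed simp

lemma bounded_linear_scalar_op: "bounded_linear scalar_op"
proof (rule bounded_linear_intro[where K = 1])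
  show "scalar_op (r *\<^sub>R c) = r *\<^sub>R scalar_op c" for r c
    by (rule blinfun_eqI) (simp add: scalar_op_apply blinfun.scaleR_left scaleR_conv_of_real)
  show "norm (scalar_op c) \<le> norm c * 1" for c
    using norm_scalar_op_le[of c id_blinfun] norm_blinfun_id_le[where 'a = "complex \<times> complex"]
    by (simp add: blinfun_compose_id)
qed (rule scalar_op_simps)

text \<open>Elements of \<^typ>\<open>op2\<close> are only real-linear; \<open>M\<^sub>2\<close> is the subalgebra of the complex-linear ones.\<close>

definition clinear :: "op2 \<Rightarrow> bool" where
  "clinear T \<longleftrightarrow> (\<forall>c. T o\<^sub>L scalar_op c = scalar_op c o\<^sub>L T)"

lemma clinear_mat2: "clinear (mat2 a b c d)"
  by (simp add: clinear_def scalar_op_def mat2_ops mult.commute)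

lemma clinear_0: "clinear 0"
  by (simp add: clinear_def)

lemma clinear_id: "clinear id_blinfun"
  using clinear_mat2[of 1 0 0 1] by (simp add: mat2_ops)

lemma clinear_add: "clinear S \<Longrightarrow> clinear T \<Longrightarrow> clinear (S + T)"
  by (simp add: clinear_def bounded_bilinear.add_left[OF bounded_bilinear_blinfun_compose]
      bounded_bilinear.add_right[OF bounded_bilinear_blinfun_compose])

lemma clinear_compose_scalar_op:
  assumes "clinear S"
  shows "S o\<^sub>L (scalar_op c o\<^sub>L T) = scalar_op c o\<^sub>L (S o\<^sub>L T)"
proof -
  have "S o\<^sub>L scalar_op c = scalar_op c o\<^sub>L S" using assms unfolding clinear_def by (rule spec)
  then show ?thesis by (simp flip: blinfun_compose_assoc)
qed

lemma clinear_compose: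
  assumes "clinear S" "clinear T"
  shows "clinear (S o\<^sub>L T)"
  unfolding clinear_def
proof
  fix c
  have "T o\<^sub>L scalar_op c = scalar_op c o\<^sub>L T" using assms(2) unfolding clinear_def by (rule spec)
  then show "(S o\<^sub>L T) o\<^sub>L scalar_op c = scalar_op c o\<^sub>L (S o\<^sub>L T)"
    by (simp add: blinfun_compose_assoc clinear_compose_scalar_op[OF assms(1)])
qed

text \<open>\<open>adj\<close> reverses compositions, which would leave the scalar on the right.
  Complex linearity moves it back to the left.\<close>

lemma adj_scalar_op_compose:
  assumes "clinear T"
  shows "adj (scalar_op c o\<^sub>L T) = scalar_op (cnj c) o\<^sub>L adj T"
proof -
  have "T o\<^sub>L scalar_op c = scalar_op c o\<^sub>L T" using assms unfolding clinear_def by (rule spec)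
  then have "adj (scalar_op c o\<^sub>L T) = adj (T o\<^sub>L scalar_op c)" by simp
  then show ?thesis by (simp add: adj_compose scalar_op_simps)
qed

lemma clinear_adj:
  assumes "clinear T"
  shows "clinear (adj T)"
  unfolding clinear_def
proof
  fix c
  show "adj T o\<^sub>L scalar_op c = scalar_op c o\<^sub>L adj T"
    using adj_scalar_op_compose[OF assms, of "cnj c"] by (simp add: adj_compose scalar_op_simps)
qed

text \<open>Composition is continuous, so commuting with a scalar survives limits. This keeps limits
  of Cauchy sequences inside the matrix algebra.\<close>

lemma clinear_limit:
  assumes "\<And>n. clinear (T n)" "T \<longlonglongrightarrow> S"
  shows "clinear S"
  unfolding clinear_def
proof
  fix c
  note b = bounded_bilinear.tendsto[OF bounded_bilinear_blinfun_compose]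
  have "(\<lambda>n. T n o\<^sub>L scalar_op c) \<longlonglongrightarrow> (scalar_op c o\<^sub>L S)"
    using b[OF tendsto_const assms(2)] assms(1) by (simp add: clinear_def)
  then show "S o\<^sub>L scalar_op c = scalar_op c o\<^sub>L S"
    using b[OF assms(2) tendsto_const] LIMSEQ_unique by blast
qed

section \<open>Continuous matrix-valued functions\<close>

text \<open>This is \<open>C(Y, M\<^sub>2)\<close> with the supremum norm, normalised as in
  \<open>cont_alg\<close>: functions are \<open>undefined\<close> off \<open>topspace Y\<close>, and
  the inserted \<open>0\<close> matters only for empty \<open>Y\<close>.\<close>

definition mat_alg :: "'y topology \<Rightarrow> ('y \<Rightarrow> op2) cstar_algebra" where
  "mat_alg Y =
    \<lparr>carrier = {F \<in> extensional (topspace Y). continuous_map Y euclidean F \<and>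
        (\<forall>y\<in>topspace Y. clinear (F y))},
     monoid.mult = (\<lambda>F G. \<lambda>y\<in>topspace Y. F y o\<^sub>L G y),
     one = (\<lambda>y\<in>topspace Y. id_blinfun),
     zero = (\<lambda>y\<in>topspace Y. 0),
     add = (\<lambda>F G. \<lambda>y\<in>topspace Y. F y + G y),
     cscale = (\<lambda>c F. \<lambda>y\<in>topspace Y. scalar_op c o\<^sub>L F y),
     cstar = (\<lambda>F. \<lambda>y\<in>topspace Y. adj (F y)),
     cnorm = (\<lambda>F. Sup (insert 0 ((\<lambda>y. norm (F y)) ` topspace Y)))\<rparr>"

lemma mat_alg_sel:
  "F \<in> carrier (mat_alg Y) \<longleftrightarrow> F \<in> extensional (topspace Y) \<and> continuous_map Y euclidean F \<and>
     (\<forall>y\<in>topspace Y. clinear (F y))"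
  "F \<otimes>\<^bsub>mat_alg Y\<^esub> G = (\<lambda>y\<in>topspace Y. F y o\<^sub>L G y)"
  "\<one>\<^bsub>mat_alg Y\<^esub> = (\<lambda>y\<in>topspace Y. id_blinfun)"
  "\<zero>\<^bsub>mat_alg Y\<^esub> = (\<lambda>y\<in>topspace Y. 0)"
  "F \<oplus>\<^bsub>mat_alg Y\<^esub> G = (\<lambda>y\<in>topspace Y. F y + G y)"
  "cscale (mat_alg Y) c F = (\<lambda>y\<in>topspace Y. scalar_op c o\<^sub>L F y)"
  "cstar (mat_alg Y) F = (\<lambda>y\<in>topspace Y. adj (F y))"
  by (simp_all add: mat_alg_def)

lemma continuous_map_restrict_iff:
  "continuous_map X Z (restrict g (topspace X)) \<longleftrightarrow> continuous_map X Z g"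
  using continuous_map_eq[of X Z g "restrict g (topspace X)"]
    continuous_map_eq[of X Z "restrict g (topspace X)" g] by auto

text \<open>A continuous image of a compact space is bounded, so the supremum is a genuine one.
  Later arguments use the norm only through these three facts.\<close>

lemma mat_alg_norm:
  assumes Y: "compact_space Y" and F: "F \<in> carrier (mat_alg Y)"
  shows "y \<in> topspace Y \<Longrightarrow> norm (F y) \<le> cnorm (mat_alg Y) F"
    and "0 \<le> cnorm (mat_alg Y) F"
    and "\<lbrakk>0 \<le> r; \<And>y. y \<in> topspace Y \<Longrightarrow> norm (F y) \<le> r\<rbrakk> \<Longrightarrow> cnorm (mat_alg Y) F \<le> r"
proof -
  have "continuous_map Y euclidean F" using F by (simp add: mat_alg_sel)
  then have "compactin euclidean (F ` topspace Y)"
    using Y compact_space_def image_compactin by blast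
  then have "bounded (F ` topspace Y)"
    by (simp add: compact_imp_bounded)
  then obtain b where "\<And>y. y \<in> topspace Y \<Longrightarrow> norm (F y) \<le> b"
    by (auto simp: bounded_iff)
  then have "bdd_above ((\<lambda>y. norm (F y)) ` topspace Y)"
    by (auto simp: bdd_above_def)
  then have "bdd_above (insert 0 ((\<lambda>y. norm (F y)) ` topspace Y))"
    by simp
  then show "y \<in> topspace Y \<Longrightarrow> norm (F y) \<le> cnorm (mat_alg Y) F"
    and "0 \<le> cnorm (mat_alg Y) F"
    by (auto simp: mat_alg_def intro!: cSup_upper)
  show "\<lbrakk>0 \<le> r; \<And>y. y \<in> topspace Y \<Longrightarrow> norm (F y) \<le> r\<rbrakk> \<Longrightarrow> cnorm (mat_alg Y) F \<le> r"
    by (auto simp: mat_alg_def intro!: cSup_least)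
qed

lemma mat_alg_ext:
  "\<lbrakk>F \<in> carrier (mat_alg Y); G \<in> carrier (mat_alg Y); \<And>y. y \<in> topspace Y \<Longrightarrow> F y = G y\<rbrakk> \<Longrightarrow> F = G"
  by (auto simp: mat_alg_sel intro: extensionalityI)

lemma mat_alg_closed:
  "\<zero>\<^bsub>mat_alg Y\<^esub> \<in> carrier (mat_alg Y)"
  "\<one>\<^bsub>mat_alg Y\<^esub> \<in> carrier (mat_alg Y)"
  "\<lbrakk>F \<in> carrier (mat_alg Y); G \<in> carrier (mat_alg Y)\<rbrakk> \<Longrightarrow> F \<oplus>\<^bsub>mat_alg Y\<^esub> G \<in> carrier (mat_alg Y)"
  "\<lbrakk>F \<in> carrier (mat_alg Y); G \<in> carrier (mat_alg Y)\<rbrakk> \<Longrightarrow> F \<otimes>\<^bsub>mat_alg Y\<^esub> G \<in> carrier (mat_alg Y)"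
  "F \<in> carrier (mat_alg Y) \<Longrightarrow> cscale (mat_alg Y) c F \<in> carrier (mat_alg Y)"
  "F \<in> carrier (mat_alg Y) \<Longrightarrow> cstar (mat_alg Y) F \<in> carrier (mat_alg Y)"
  using clinear_mat2[of c 0 0 c]
  by (simp_all add: mat_alg_sel continuous_map_restrict_iff clinear_0 clinear_id clinear_add
      clinear_compose clinear_adj flip: scalar_op_def)
    (simp_all add: continuous_map_atin tendsto_add bounded_linear.tendsto[OF bounded_linear_adj]
      bounded_bilinear.tendsto[OF bounded_bilinear_blinfun_compose])

lemma unital_cstar_algebra_mat_alg:
  assumes Y: "compact_space Y"
  shows "unital_cstar_algebra (mat_alg Y)"
proof (rule unital_cstar_algebraI)
  let ?C = "mat_alg Y"
  note n = mat_alg_norm[OF Y]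
  note cl = mat_alg_closed
  show "0 \<le> cnorm ?C F" if "F \<in> carrier ?C" for F
    using n(2)[OF that] .
  show "cnorm ?C F = 0 \<longleftrightarrow> F = \<zero>\<^bsub>?C\<^esub>" if a: "F \<in> carrier ?C" for F
  proof
    assume z: "cnorm ?C F = 0"
    show "F = \<zero>\<^bsub>?C\<^esub>"
    proof (rule mat_alg_ext[OF a cl(1)])
      fix y assume y: "y \<in> topspace Y"
      then show "F y = \<zero>\<^bsub>?C\<^esub> y" using n(1)[OF a y] z by (simp add: mat_alg_sel)
    qed
  next
    assume "F = \<zero>\<^bsub>?C\<^esub>"
    then have "cnorm ?C F \<le> 0" by (intro n(3)[OF a]) (simp_all add: mat_alg_sel)
    then show "cnorm ?C F = 0" using n(2)[OF a] by simp
  qed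
  show "cnorm ?C (F \<oplus>\<^bsub>?C\<^esub> G) \<le> cnorm ?C F + cnorm ?C G"
    if a: "F \<in> carrier ?C" and b: "G \<in> carrier ?C" for F G
  proof (rule n(3)[OF cl(3)[OF a b]])
    fix y assume y: "y \<in> topspace Y"
    show "norm ((F \<oplus>\<^bsub>?C\<^esub> G) y) \<le> cnorm ?C F + cnorm ?C G"
      using n(1)[OF a y] n(1)[OF b y] norm_triangle_ineq[of "F y" "G y"] y
      by (simp add: mat_alg_sel)
  qed (use n(2)[OF a] n(2)[OF b] in simp)
  have le: "cnorm ?C (cscale ?C c F) \<le> cmod c * cnorm ?C F"
    if a: "F \<in> carrier ?C" for c F
  proof (rule n(3)[OF cl(5)[OF a]])
    fix y assume y: "y \<in> topspace Y"
    show "norm (cscale ?C c F y) \<le> cmod c * cnorm ?C F"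
      using order_trans[OF norm_scalar_op_le mult_left_mono[OF n(1)[OF a y] norm_ge_zero]] y
      by (simp add: mat_alg_sel)
  qed (use n(2)[OF a] in simp)
  show "cnorm ?C (cscale ?C c F) = cmod c * cnorm ?C F" if a: "F \<in> carrier ?C" for c F
  proof (cases "c = 0")
    case True
    then show ?thesis using le[OF a, of 0] n(2)[OF cl(5)[OF a], of 0] by simp
  next
    case False
    \<comment> \<open>The reverse inequality comes from \<open>le\<close> for the scalar
      \<open>inverse c\<close>, applied to the scaled function.\<close>
    have "cscale ?C (inverse c) (cscale ?C c F) = F"
      by (rule mat_alg_ext[OF cl(5)[OF cl(5)[OF a]] a])
        (simp add: mat_alg_sel scalar_op_simps False blinfun_compose_id flip: blinfun_compose_assoc)
    then have "cnorm ?C F \<le> inverse (cmod c) * cnorm ?C (cscale ?C c F)"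
      using le[OF cl(5)[OF a], of "inverse c" c] by (simp add: norm_inverse)
    then have "cmod c * cnorm ?C F \<le> cnorm ?C (cscale ?C c F)"
      using False by (simp add: field_simps)
    then show ?thesis using le[OF a, of c] by simp
  qed
  show M: "cnorm ?C (F \<otimes>\<^bsub>?C\<^esub> G) \<le> cnorm ?C F * cnorm ?C G"
    if a: "F \<in> carrier ?C" and b: "G \<in> carrier ?C" for F G
  proof (rule n(3)[OF cl(4)[OF a b]])
    fix y assume y: "y \<in> topspace Y"
    have "norm (F y o\<^sub>L G y) \<le> norm (F y) * norm (G y)" by (rule norm_blinfun_compose)
    also have "\<dots> \<le> cnorm ?C F * cnorm ?C G"
      using n(1)[OF a y] n(1)[OF b y] n(2)[OF a] by (simp add: mult_mono)
    finally show "norm ((F \<otimes>\<^bsub>?C\<^esub> G) y) \<le> cnorm ?C F * cnorm ?C G" using y by (simp add: mat_alg_sel)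
  qed (use n(2)[OF a] n(2)[OF b] in simp)
  show "cnorm ?C (cstar ?C F \<otimes>\<^bsub>?C\<^esub> F) = (cnorm ?C F)\<^sup>2" if a: "F \<in> carrier ?C" for F
  proof (rule antisym)
    let ?p = "cstar ?C F \<otimes>\<^bsub>?C\<^esub> F"
    have p: "?p \<in> carrier ?C" using cl(4)[OF cl(6)[OF a] a] .
    have p_norm: "norm (?p y) = (norm (F y))\<^sup>2" if "y \<in> topspace Y" for y
      using that by (simp add: mat_alg_sel norm_adj_compose)
    show "cnorm ?C ?p \<le> (cnorm ?C F)\<^sup>2"
      by (rule n(3)[OF p]) (simp_all add: p_norm power_mono n(1)[OF a])
    \<comment> \<open>Since \<open>n(3)\<close> bounds \<open>cnorm ?C F\<close> and not its square,
      the pointwise identity \<open>p_norm\<close> is used after taking square roots.\<close>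
    have "cnorm ?C F \<le> sqrt (cnorm ?C ?p)"
    proof (rule n(3)[OF a])
      fix y assume "y \<in> topspace Y"
      then show "norm (F y) \<le> sqrt (cnorm ?C ?p)"
        using n(1)[OF p] p_norm by (intro real_le_rsqrt) metis
    qed (use n(2)[OF p] in simp)
    then have "(cnorm ?C F)\<^sup>2 \<le> (sqrt (cnorm ?C ?p))\<^sup>2"
      by (rule power_mono) (rule n(2)[OF a])
    then show "(cnorm ?C F)\<^sup>2 \<le> cnorm ?C ?p" using n(2)[OF p] by simp
  qed
  \<comment> \<open>\<open>unital_cstar_algebraI\<close> writes subtraction as addition of the
    multiple by \<open>-1\<close>.\<close>
  have minus: "scalar_op (-1) o\<^sub>L T = - T" for T
    by (rule blinfun_eqI) (simp add: scalar_op_apply blinfun.minus_left prod_eq_iff)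
  show "\<exists>l\<in>carrier ?C. (\<lambda>k. cnorm ?C (\<sigma> k \<oplus>\<^bsub>?C\<^esub> cscale ?C (-1) l)) \<longlonglongrightarrow> 0"
    if a: "\<And>k. \<sigma> k \<in> carrier ?C"
      and b: "\<And>e. e > 0 \<Longrightarrow> \<exists>N. \<forall>m\<ge>N. \<forall>k\<ge>N. cnorm ?C (\<sigma> m \<oplus>\<^bsub>?C\<^esub> cscale ?C (-1) (\<sigma> k)) < e" for \<sigma>
  proof -
    have d: "dist (\<sigma> m y) (\<sigma> k y) \<le> cnorm ?C (\<sigma> m \<oplus>\<^bsub>?C\<^esub> cscale ?C (-1) (\<sigma> k))"
      if "y \<in> topspace Y" for y m k
      using n(1)[OF cl(3)[OF a cl(5)[OF a]] that, of m "-1" k] that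
      by (simp add: mat_alg_sel dist_norm minus)
    \<comment> \<open>Cauchy in the supremum norm means uniformly Cauchy on \<open>Y\<close>, so
      completeness of \<open>op2\<close> yields a continuous uniform limit.\<close>
    have cu: "\<exists>N. \<forall>m k y. N \<le> m \<longrightarrow> N \<le> k \<longrightarrow> y \<in> topspace Y \<longrightarrow> dist (\<sigma> m y) (\<sigma> k y) < e"
      if "e > 0" for e
      using b[OF that] d by (meson order_le_less_trans)
    have cc: "\<forall>\<^sub>F k in sequentially. continuous_map Y Met_TC.mtopology (\<sigma> k)"
      using a by (simp add: mat_alg_sel)
    have "Met_TC.mcomplete TYPE(op2)" by (simp add: complete_UNIV)
    from Met_TC.continuous_map_uniformly_Cauchy_limit[OF this cc cu]
    obtain g where g: "continuous_map Y Met_TC.mtopology g"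
      and lim: "\<And>e. 0 < e \<Longrightarrow> \<forall>\<^sub>F k in sequentially. \<forall>y\<in>topspace Y. dist (\<sigma> k y) (g y) < e"
      by blast
    have "clinear (g y)" if y: "y \<in> topspace Y" for y
    proof (rule clinear_limit)
      show "clinear (\<sigma> k y)" for k using a y by (simp add: mat_alg_sel)
      show "(\<lambda>k. \<sigma> k y) \<longlonglongrightarrow> g y"
        by (rule tendstoI, rule eventually_mono[OF lim]) (use y in auto)
    qed
    then have l: "restrict g (topspace Y) \<in> carrier ?C" (is "?l \<in> _")
      using g by (simp add: mat_alg_sel continuous_map_restrict_iff)
    have "(\<lambda>k. cnorm ?C (\<sigma> k \<oplus>\<^bsub>?C\<^esub> cscale ?C (-1) ?l)) \<longlonglongrightarrow> 0"
    proof (rule LIMSEQ_I)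
      fix r :: real assume r: "0 < r"
      obtain N where N: "\<And>k y. N \<le> k \<Longrightarrow> y \<in> topspace Y \<Longrightarrow> dist (\<sigma> k y) (g y) < r/2"
        using lim[of "r/2"] r by (auto simp: eventually_sequentially)
      have "norm (cnorm ?C (\<sigma> k \<oplus>\<^bsub>?C\<^esub> cscale ?C (-1) ?l) - 0) < r" if "k \<ge> N" for k
      proof -
        note q = cl(3)[OF a cl(5)[OF l], of k "-1"]
        have "cnorm ?C (\<sigma> k \<oplus>\<^bsub>?C\<^esub> cscale ?C (-1) ?l) \<le> r/2"
          by (rule n(3)[OF q])
            (use r N[OF that] in \<open>auto simp: mat_alg_sel dist_norm minus intro: less_imp_le\<close>)
        then show ?thesis using n(2)[OF q] r by simp
      qed
      then show "\<exists>N. \<forall>k\<ge>N. norm (cnorm ?C (\<sigma> k \<oplus>\<^bsub>?C\<^esub> cscale ?C (-1) ?l) - 0) < r" by blast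
    qed
    then show ?thesis using l by blast
  qed
  show "cstar ?C (cscale ?C c F) = cscale ?C (cnj c) (cstar ?C F)" if "F \<in> carrier ?C" for c F
    using that by (auto simp: mat_alg_sel adj_scalar_op_compose intro!: restrict_ext)
  show "F \<otimes>\<^bsub>?C\<^esub> cscale ?C c G = cscale ?C c (F \<otimes>\<^bsub>?C\<^esub> G)"
    if "F \<in> carrier ?C" "G \<in> carrier ?C" for c F G
    using that by (auto simp: mat_alg_sel clinear_compose_scalar_op intro!: restrict_ext)
  show "cscale ?C c (cscale ?C d F) = cscale ?C (c * d) F" if "F \<in> carrier ?C" for c d F
    by (auto simp: mat_alg_sel scalar_op_simps intro!: restrict_ext simp flip: blinfun_compose_assoc)
  show "F \<oplus>\<^bsub>?C\<^esub> G = G \<oplus>\<^bsub>?C\<^esub> F" for F G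
    by (simp add: mat_alg_sel add.commute)
qed (simp_all only: mat_alg_closed,
    auto simp: mat_alg_sel scalar_op_simps adj_adj adj_add adj_compose add.assoc
      blinfun_compose_assoc blinfun_compose_id extensional_restrict
      bounded_bilinear.add_left[OF bounded_bilinear_blinfun_compose]
      bounded_bilinear.add_right[OF bounded_bilinear_blinfun_compose]
      intro!: restrict_ext extensionalityI[where A = "topspace Y"])

text \<open>A matrix is the sum of its entries times the matrix units, and \<open>scalar_op\<close>
  and composition are continuous.\<close>

lemma continuous_map_mat2:
  assumes "continuous_map X euclidean a" "continuous_map X euclidean b"
    "continuous_map X euclidean c" "continuous_map X euclidean d"
  shows "continuous_map X euclidean (\<lambda>x. mat2 (a x) (b x) (c x) (d x))"
proof -
  have "continuous_map X euclidean (\<lambda>x. (scalar_op (a x) o\<^sub>L mat2 1 0 0 0) +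
      (scalar_op (b x) o\<^sub>L mat2 0 1 0 0) + (scalar_op (c x) o\<^sub>L mat2 0 0 1 0) +
      (scalar_op (d x) o\<^sub>L mat2 0 0 0 1))"
    using assms
    by (simp add: continuous_map_atin tendsto_add bounded_linear.tendsto[OF bounded_linear_scalar_op]
        bounded_bilinear.tendsto[OF bounded_bilinear_blinfun_compose])
  then show ?thesis by (simp add: scalar_op_def mat2_ops)
qed

section \<open>The lifting problem\<close>

text \<open>The argument concerns a single fibre. By \<open>limit\<close> its base point is not
  isolated, so continuity carries information from the other points of \<open>Y\<close> to
  it.\<close>

lemma doubly_projective_cont_alg_map_inj:
  fixes X :: "'x topology" and Y :: "'y topology"
  assumes X: "compact_space X" "Hausdorff_space X"
    and Y: "compact_space Y" "Hausdorff_space Y"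
    and f: "continuous_map X Y f"
    and dp: "doubly_projective (cont_alg Y) (cont_alg X) (cont_alg_map X f)"
    and x: "x0 \<in> topspace X" "x1 \<in> topspace X" "f x0 = f x1"
    and limit: "\<not> openin Y {f x0}"
  shows "x0 = x1"
proof (rule ccontr)
  assume "x0 \<noteq> x1"
  define y0 where "y0 = f x0"
  have y0: "y0 \<in> topspace Y"
    using f x by (auto simp: y0_def continuous_map_def)
  have cr: "completely_regular_space X" "completely_regular_space Y"
    using X Y by (simp_all add: compact_Hausdorff_or_regular_imp_normal_space
        normal_imp_completely_regular_space)
  \<comment> \<open>Stated for a general \<open>Z\<close> because it is needed on \<open>X\<close>
    to choose \<open>t\<close> and on \<open>Y\<close> to choose \<open>\<phi>\<close>.\<close>
  have sep: "\<exists>\<phi>\<in>carrier (cont_alg Z). \<phi> a \<noteq> \<phi> b"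
    if "completely_regular_space Z" "Hausdorff_space Z" "a \<in> topspace Z" "b \<in> topspace Z" "a \<noteq> b"
    for Z :: "'z topology" and a b
  proof -
    have "closedin Z {b}" "a \<in> topspace Z - {b}"
      using that by (simp_all add: closedin_Hausdorff_singleton)
    with that(1) have "\<exists>q. continuous_map Z euclideanreal q \<and> q a = 0 \<and> q ` {b} \<subseteq> {1}"
      unfolding completely_regular_space_alt by blast
    then obtain q :: "'z \<Rightarrow> real" where q: "continuous_map Z euclideanreal q" "q a = 0" "q b = 1"
      by auto
    have "continuous_map Z euclidean (\<lambda>z. complex_of_real (q z))"
      using q(1) by (simp add: continuous_map_atin tendsto_of_real)
    then have "(\<lambda>z\<in>topspace Z. complex_of_real (q z)) \<in> carrier (cont_alg Z)"
      by (simp add: cont_alg_sel continuous_map_restrict_iff)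
    then show ?thesis using that q by (intro bexI) auto
  qed
  \<comment> \<open>\<open>mat_alg P\<close> serves as \<open>M\<^sub>2\<close>.\<close>
  define P where "P = subtopology Y {y0}"
  have P: "topspace P = {y0}" using y0 by (auto simp: P_def)
  have "compact_space P" unfolding P_def
    using y0 by (intro compact_space_subtopology) simp
  \<comment> \<open>At \<open>y0\<close> this is the scalar matrix \<open>\<phi> y0\<close>, which
    conjugation by a unitary leaves fixed.\<close>
  define u where "u = (\<lambda>\<phi>. \<lambda>y\<in>topspace Y. mat2 (\<phi> y) 0 0 (\<phi> y0))"
  \<comment> \<open>The product of the 45 degree rotation, the diagonal matrix with entries
    \<open>t x0\<close> and \<open>t x1\<close>, and the inverse rotation, multiplied out.\<close>
  define g where "g = (\<lambda>t. \<lambda>y\<in>{y0}.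
    mat2 ((t x0 + t x1) / 2) ((t x0 - t x1) / 2) ((t x0 - t x1) / 2) ((t x0 + t x1) / 2))"
  define p where "p = (\<lambda>F :: 'y \<Rightarrow> op2. restrict F {y0})"
  have u: "u \<in> unital_star_hom (cont_alg Y) (mat_alg Y)"
    using y0 by (auto simp: unital_star_hom_def ring_hom_def u_def cont_alg_sel mat_alg_sel
        continuous_map_restrict_iff continuous_map_mat2 clinear_mat2 mat2_ops adj_mat2 scalar_op_def
        intro!: restrict_ext)
  have g: "g \<in> unital_star_hom (cont_alg X) (mat_alg P)"
  proof -
    have "continuous_map P euclidean (\<lambda>y\<in>{y0}. T)" for T :: op2
      using continuous_map_restrict_iff[of P euclidean "\<lambda>_. T"] by (simp add: P)
    then show ?thesis
      using x by (auto simp: unital_star_hom_def ring_hom_def g_def cont_alg_sel mat_alg_sel P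
        clinear_mat2 mat2_ops adj_mat2 scalar_op_def mat2_eq_iff field_simps intro!: restrict_ext)
  qed
  have p: "p \<in> unital_star_hom (mat_alg Y) (mat_alg P)"
  proof -
    have "continuous_map P euclidean (restrict F {y0})"
      if "continuous_map Y euclidean F" for F :: "'y \<Rightarrow> op2"
      using continuous_map_restrict_iff[of P euclidean F]
        continuous_map_from_subtopology[OF that, of "{y0}"] P by (simp add: P_def)
    then show ?thesis
      using y0 by (auto simp: unital_star_hom_def ring_hom_def p_def mat_alg_sel P)
  qed
  have surj: "p ` carrier (mat_alg Y) = carrier (mat_alg P)"
  proof (rule subset_antisym)
    show "p ` carrier (mat_alg Y) \<subseteq> carrier (mat_alg P)"
      using unital_star_hom_closed[OF p] by (rule image_subsetI)
    show "carrier (mat_alg P) \<subseteq> p ` carrier (mat_alg Y)"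
    proof
      fix G assume G: "G \<in> carrier (mat_alg P)"
      \<comment> \<open>A matrix over the point \<open>y0\<close> extends to a constant function on
        \<open>Y\<close>.\<close>
      then have "(\<lambda>y\<in>topspace Y. G y0) \<in> carrier (mat_alg Y)"
        by (simp add: mat_alg_sel continuous_map_restrict_iff P)
      moreover have "G = p (\<lambda>y\<in>topspace Y. G y0)"
        using G y0 by (auto simp: mat_alg_sel p_def P intro!: extensionalityI[where A = "{y0}"])
      ultimately show "G \<in> p ` carrier (mat_alg Y)" by blast
    qed
  qed
  \<comment> \<open>A function pulled back along \<open>f\<close> agrees at \<open>x0\<close> and
    \<open>x1\<close>, so the off-diagonal entries of \<open>g\<close> vanish.\<close>
  have comm: "g (cont_alg_map X f \<phi>) = p (u \<phi>)" for \<phi>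
    using x y0 by (auto simp: g_def p_def u_def cont_alg_map_def y0_def)
  have lifts: "lifts_against (cont_alg Y) (cont_alg X) (cont_alg_map X f) (mat_alg Y) (mat_alg P)"
    by (rule doubly_projective_lifts[OF dp])
      (rule unital_cstar_algebra_mat_alg, fact)+
  then obtain h where h: "h \<in> unital_star_hom (cont_alg X) (mat_alg Y)"
    and hu: "\<And>\<phi>. \<phi> \<in> carrier (cont_alg Y) \<Longrightarrow> u \<phi> = h (cont_alg_map X f \<phi>)"
    and hg: "\<And>t. t \<in> carrier (cont_alg X) \<Longrightarrow> g t = p (h t)"
    using lifts[unfolded lifts_against_def, rule_format, OF u g p surj comm] by blast
  obtain t where t: "t \<in> carrier (cont_alg X)" "t x0 \<noteq> t x1"
    using sep[OF cr(1) X(2) x(1,2) \<open>x0 \<noteq> x1\<close>] by blast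
  have ht: "h t \<in> carrier (mat_alg Y)" using unital_star_hom_closed[OF h t(1)] .
  \<comment> \<open>Only the lower left entry is followed; it is the second coordinate of the image
    of \<open>(1, 0)\<close>.\<close>
  have diag: "snd (h t y (1, 0)) = 0" if y: "y \<in> topspace Y" "y \<noteq> y0" for y
  proof -
    obtain \<phi> where \<phi>: "\<phi> \<in> carrier (cont_alg Y)" "\<phi> y \<noteq> \<phi> y0"
      using sep[OF cr(2) Y(2) y(1) y0 y(2)] by blast
    have f\<phi>: "cont_alg_map X f \<phi> \<in> carrier (cont_alg X)"
      using unital_star_hom_closed[OF cont_alg_map_hom[OF f] \<phi>(1)] .
    have hm: "h (a \<otimes>\<^bsub>cont_alg X\<^esub> b) = h a \<otimes>\<^bsub>mat_alg Y\<^esub> h b"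
      if "a \<in> carrier (cont_alg X)" "b \<in> carrier (cont_alg X)" for a b
      using h that by (simp add: unital_star_hom_def ring_hom_def)
    \<comment> \<open>Commutativity of \<open>C(X)\<close> passes through \<open>h\<close>, so
      \<open>h t\<close> commutes with \<open>u \<phi>\<close>.\<close>
    have "t \<otimes>\<^bsub>cont_alg X\<^esub> cont_alg_map X f \<phi> = cont_alg_map X f \<phi> \<otimes>\<^bsub>cont_alg X\<^esub> t"
      by (simp add: cont_alg_sel mult.commute)
    then have "h t \<otimes>\<^bsub>mat_alg Y\<^esub> u \<phi> = u \<phi> \<otimes>\<^bsub>mat_alg Y\<^esub> h t"
      using hm[OF t(1) f\<phi>] hm[OF f\<phi> t(1)] hu[OF \<phi>(1)] by simp
    from fun_cong[OF this, of y]
    have "h t y o\<^sub>L mat2 (\<phi> y) 0 0 (\<phi> y0) = mat2 (\<phi> y) 0 0 (\<phi> y0) o\<^sub>L h t y"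
      using y by (simp add: mat_alg_sel u_def)
    from arg_cong[OF this, of "\<lambda>T. T (1, 0)"]
    have "h t y (mat2 (\<phi> y) 0 0 (\<phi> y0) (1, 0)) = mat2 (\<phi> y) 0 0 (\<phi> y0) (h t y (1, 0))"
      by simp
    \<comment> \<open>The vector \<open>(1, 0)\<close> is an eigenvector of the diagonal matrix for
      \<open>\<phi> y\<close>. Pulling this scalar out of \<open>h t y\<close> shows that the lower
      left entry has the same product with \<open>\<phi> y\<close> as with \<open>\<phi> y0\<close>,
      hence is zero.\<close>
    moreover have "h t y o\<^sub>L scalar_op (\<phi> y) = scalar_op (\<phi> y) o\<^sub>L h t y"
      using ht y by (simp add: mat_alg_sel clinear_def)
    from arg_cong[OF this, of "\<lambda>T. T (1, 0)"]
    have "h t y (scalar_op (\<phi> y) (1, 0)) = scalar_op (\<phi> y) (h t y (1, 0))"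
      by simp
    ultimately show ?thesis using \<phi>(2) by (auto simp: mat2_apply scalar_op_apply)
  qed
  \<comment> \<open>The entry vanishes on a closed set containing every point except possibly
    \<open>y0\<close>. If \<open>y0\<close> were missing, \<open>{y0}\<close> would be open.\<close>
  let ?Z = "{y \<in> topspace Y. snd (h t y (1, 0)) \<in> {0}}"
  have "continuous_map Y euclidean (\<lambda>y. snd (h t y (1, 0)))"
    using ht by (simp add: mat_alg_sel continuous_map_atin tendsto_snd blinfun.tendsto)
  then have Z: "closedin Y ?Z"
    by (rule closedin_continuous_map_preimage) simp
  have "snd (h t y0 (1, 0)) = 0"
  proof (rule ccontr)
    assume "snd (h t y0 (1, 0)) \<noteq> 0"
    then have "topspace Y - ?Z = {y0}" using diag y0 by auto
    with Z limit show False unfolding closedin_def y0_def by simp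
  qed
  moreover have "h t y0 = g t y0" by (simp add: hg[OF t(1)] p_def)
  \<comment> \<open>The lower left entry of \<open>g t y0\<close> is
    \<open>(t x0 - t x1) / 2\<close>, which is nonzero by the choice of \<open>t\<close>.\<close>
  ultimately show False using t(2) by (simp add: g_def mat2_apply)
qed

theorem theorem1p2:
  fixes X :: "'x topology" and Y :: "'y topology" and f :: "'x \<Rightarrow> 'y"
  assumes "compact_space X" and "Hausdorff_space X"
    and "peano_continuum Y"
    and "\<exists>y\<in>topspace Y. \<exists>y'\<in>topspace Y. y \<noteq> y'"
    and "continuous_map X Y f" and "f ` topspace X = topspace Y"
    and "doubly_projective (cont_alg Y) (cont_alg X) (cont_alg_map X f)"
  shows "homeomorphic_map X Y f"
\<comment> \<open>A continuous bijection from a compact space to a Hausdorff space is a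
  homeomorphism, so injectivity is the point to prove.\<close>
proof (rule continuous_imp_homeomorphic_map)
  have Y: "compact_space Y" "Hausdorff_space Y" "connected_space Y"
    using assms(3) by (auto simp: peano_continuum_def metrizable_imp_Hausdorff_space)
  then show "Hausdorff_space Y" by simp
  show "inj_on f (topspace X)"
  proof (rule inj_onI)
    fix x0 x1 assume x: "x0 \<in> topspace X" "x1 \<in> topspace X" "f x0 = f x1"
    then have "closedin Y {f x0}"
      using Y(2) assms(6) by (auto intro: closedin_Hausdorff_singleton)
    moreover have "{f x0} \<noteq> topspace Y"
      using assms(4) by (metis singletonD)
    \<comment> \<open>In a connected space with more than one point, a closed singleton cannot also
      be open.\<close>
    ultimately have "\<not> openin Y {f x0}"
      using Y(3) unfolding connected_space_clopen_in by blast
    then show "x0 = x1"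
      by (rule doubly_projective_cont_alg_map_inj[OF assms(1,2) Y(1,2) assms(5,7) x])
  qed
qed (use assms in auto)

end
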